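(* Let $a_1,a_2,a_3,b_1,b_2\in\mathbb{R}$ with $(a_1,a_2,a_3)\neq(0,0,0)$ and consider the system on the unit sphere $\mathbb{S}^2\subset\mathbb{R}^3$ $$\begin{cases} z_1'=z_3\left(-z_2z_3+b_1z_1^2z_3^2+b_2z_1z_2z_3^2+a_1z_1^4+a_2z_1^3z_2+a_3z_1^2z_2^2\right),\\ z_2'=z_3\left(z_1z_3+b_1z_1z_2z_3^2+b_2z_2^2z_3^2+a_1z_1^3z_2+a_2z_1^2z_2^2+a_3z_1z_2^3\right),\\ z_3'=(z_3^2-1)\left(b_1z_1z_3^2+b_2z_2z_3^2+a_1z_1^3+a_2z_1^2z_2+a_3z_1z_2^2\right). \end{cases}$$ If the system has two cusps and no other critical points on the equator $\{z_3=0\}$, then it has a periodic solution on the sphere which is symmetric with respect to the origin (its orbit is invariant under $z\mapsto-z$) and whose intersection with the equator consists of two (antipodal) regular points.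
   Context: A cusp is a critical point having a neighbourhood consisting of exactly two hyperbolic sectors (with one orbit tending to the point and one orbit leaving it as separatrices). A regular point is a point at which the vector field does not vanish. A periodic solution is a nonconstant periodic solution. *)

theory Defs
  imports "HOL-Analysis.Analysis"
begin

definition sphere_field :: "real \<Rightarrow> real \<Rightarrow> real \<Rightarrow> real \<Rightarrow> real \<Rightarrow> real^3 \<Rightarrow> real^3" where
  "sphere_field a1 a2 a3 b1 b2 z =
    (let z1 = z $ 1; z2 = z $ 2; z3 = z $ 3 in vector
      [z3 * (- z2*z3 + b1*z1^2*z3^2 + b2*z1*z2*z3^2 + a1*z1^4 + a2*z1^3*z2 + a3*z1^2*z2^2),
       z3 * (z1*z3 + b1*z1*z2*z3^2 + b2*z2^2*z3^2 + a1*z1^3*z2 + a2*z1^2*z2^2 + a3*z1*z2^3),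
       (z3^2 - 1) * (b1*z1*z3^2 + b2*z2*z3^2 + a1*z1^3 + a2*z1^2*z2 + a3*z1*z2^2)])"

definition unit_sphere :: "(real^3) set" where
  "unit_sphere = sphere 0 1"

definition equator :: "(real^3) set" where
  "equator = {z \<in> unit_sphere. z $ 3 = 0}"

(* Solutions are taken on the whole time axis; on the compact sphere every maximal solution of
   a smooth tangent field is of this kind. *)
definition solution_in ::
    "('a::real_normed_vector \<Rightarrow> 'a) \<Rightarrow> 'a set \<Rightarrow> (real \<Rightarrow> 'a) \<Rightarrow> bool" where
  "solution_in X M x \<longleftrightarrow>
    (\<forall>t. x t \<in> M \<and> (x has_vector_derivative X (x t)) (at t))"

definition periodic_solution_in ::
    "('a::real_normed_vector \<Rightarrow> 'a) \<Rightarrow> 'a set \<Rightarrow> (real \<Rightarrow> 'a) \<Rightarrow> bool" where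
  "periodic_solution_in X M x \<longleftrightarrow>
    solution_in X M x \<and> (\<exists>T>0. \<forall>t. x (t + T) = x t) \<and> \<not> x constant_on UNIV"

(* The model hyperbolic sector: the flow of u' = u, v' = -v on the closed unit square. The side
   u = 0 is the separatrix tending to the vertex (0,0), the side v = 0 the one leaving it. *)
definition saddle_flow :: "real \<Rightarrow> real \<times> real \<Rightarrow> real \<times> real" where
  "saddle_flow t q = (exp t * fst q, exp (- t) * snd q)"

definition model_sector :: "(real \<times> real) set" where
  "model_sector = {0..1} \<times> {0..1}"

definition model_incoming :: "(real \<times> real) set" where
  "model_incoming = {0} \<times> {0..1}"

definition model_outgoing :: "(real \<times> real) set" where
  "model_outgoing = {0..1} \<times> {0}"

(* S is a hyperbolic sector with vertex p: h is a homeomorphism of the model onto S that carries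
   the orbit arcs of the model to orbit arcs of X, with the same orientation (\<tau> is the change of
   time along an arc). *)
definition hyperbolic_sector ::
    "('a::real_normed_vector \<Rightarrow> 'a) \<Rightarrow> 'a set \<Rightarrow> 'a \<Rightarrow> (real \<times> real \<Rightarrow> 'a) \<Rightarrow> 'a set \<Rightarrow> bool" where
  "hyperbolic_sector X M p h S \<longleftrightarrow>
    (\<exists>g. homeomorphism model_sector S h g) \<and> h (0, 0) = p \<and>
    (\<forall>q \<in> model_sector - {(0, 0)}. \<exists>x \<tau>. solution_in X M x \<and>
       strict_mono_on {t. saddle_flow t q \<in> model_sector} \<tau> \<and>
       (\<forall>t. saddle_flow t q \<in> model_sector \<longrightarrow> h (saddle_flow t q) = x (\<tau> t)))"

(* The two sectors meet exactly along the incoming and the outgoing separatrix, and together they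
   form a neighbourhood of p relative to M. *)
definition cusp :: "('a::real_normed_vector \<Rightarrow> 'a) \<Rightarrow> 'a set \<Rightarrow> 'a \<Rightarrow> bool" where
  "cusp X M p \<longleftrightarrow> p \<in> M \<and> X p = 0 \<and>
    (\<exists>h1 S1 h2 S2.
       hyperbolic_sector X M p h1 S1 \<and> hyperbolic_sector X M p h2 S2 \<and>
       h1 ` model_incoming = h2 ` model_incoming \<and>
       h1 ` model_outgoing = h2 ` model_outgoing \<and>
       S1 \<inter> S2 = h1 ` model_incoming \<union> h1 ` model_outgoing \<and>
       (\<exists>U. openin (top_of_set M) U \<and> p \<in> U \<and> U \<subseteq> S1 \<union> S2))"

end

theory Submission
  imports Defs
begin

text \<open>In the coordinates \<open>z = (cos \<theta>, sin \<theta>, \<mp>w) / sqrt (1 + w\<^sup>2)\<close>, which cover the sphere minus its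
  poles, the system becomes \<open>\<theta>' = lat w\<close>, \<open>w' = B \<theta> * lat w + A \<theta> * (1 - lat w)\<close> with
  \<open>lat w = w\<^sup>2 / (1 + w\<^sup>2)\<close>, a globally Lipschitz field on the plane; \<open>A\<close> and \<open>B\<close> change sign under
  \<open>\<theta> \<mapsto> \<theta> + pi\<close>. If the equator carries only two critical points, they are \<open>\<theta> = \<plusminus>pi / 2\<close>, and \<open>A\<close> has
  a constant sign, say positive, between them. The orbit from \<open>(s, 0)\<close> with \<open>\<bar>s\<bar> < pi / 2\<close> then stays
  in \<open>w > 0\<close> until it meets the meridian \<open>\<theta> = pi / 2\<close> at a height \<open>c s\<close>, unless it tends to the critical
  point; if one orbit does so then so do all those starting further right, while at most one orbit
  tends to a cusp. So \<open>c\<close> is defined, continuous and decreasing, with limit 0 at \<open>pi / 2\<close>. The same holds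
  for the height \<open>c'\<close> obtained by following the orbit backwards from \<open>(s + pi, 0)\<close>, with the roles of
  the two ends exchanged. The intermediate value theorem gives \<open>c s = c' s\<close>, that is, an orbit from
  \<open>(s, 0)\<close> to its antipode \<open>(s + pi, 0)\<close>, and the symmetry of the field closes it up.\<close>

subsection \<open>Ordinary differential equations with a Lipschitz right-hand side\<close>

lemma solution_in_shift:
  assumes "solution_in X M x"
  shows "solution_in X M (\<lambda>t. x (t + c))"
  unfolding solution_in_def
proof (intro allI conjI)
  fix t
  have "(x has_vector_derivative X (x (t + c))) (at (t + c))"
    using assms by (simp add: solution_in_def)
  moreover have "((\<lambda>t. t + c) has_real_derivative 1) (at t)"
    by (auto intro!: derivative_eq_intros)
  ultimately show "((\<lambda>t. x (t + c)) has_vector_derivative X (x (t + c))) (at t)"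
    using vector_diff_chain_at[of "\<lambda>t. t + c" 1 t x "X (x (t + c))"]
    by (simp add: o_def has_real_derivative_iff_has_vector_derivative)
qed (use assms in \<open>simp add: solution_in_def\<close>)

lemma solution_in_reverse:
  assumes "solution_in X M x"
  shows "solution_in (\<lambda>z. - X z) M (\<lambda>t. x (- t))"
  unfolding solution_in_def
proof (intro allI conjI)
  fix t
  have "(x has_vector_derivative X (x (- t))) (at (- t))"
    using assms by (simp add: solution_in_def)
  moreover have "(uminus has_real_derivative -1) (at t)"
    by (auto intro!: derivative_eq_intros)
  ultimately show "((\<lambda>t. x (- t)) has_vector_derivative - X (x (- t))) (at t)"
    using vector_diff_chain_at[of uminus "-1" t x "X (x (- t))"]
    by (simp add: o_def has_real_derivative_iff_has_vector_derivative)
qed (use assms in \<open>simp add: solution_in_def\<close>)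

text \<open>Gronwall's inequality for the squared distance: by Cauchy-Schwarz its derivative is at
  most \<open>2 * L\<close> times itself, so the damped quantity \<open>N\<close> cannot grow. The
  square stays differentiable where the solutions meet.\<close>

lemma gronwall_forward:
  fixes X :: "'a::real_inner \<Rightarrow> 'a"
  assumes x: "solution_in X M x" and y: "solution_in X M y"
    and L: "L-lipschitz_on M X" and t: "0 \<le> t"
  shows "norm (x t - y t) \<le> exp (L * t) * norm (x 0 - y 0)"
proof -
  define N where "N t = (x t - y t) \<bullet> (x t - y t) * exp (- 2 * L * t)" for t
  have "N t \<le> N 0"
  proof (rule DERIV_nonpos_imp_nonincreasing[OF t])
    fix r
    define d where "d = x r - y r"
    define e where "e = X (x r) - X (y r)"
    have "((\<lambda>t. x t - y t) has_vector_derivative e) (at r)"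
      using x y unfolding solution_in_def e_def by (auto intro!: derivative_intros)
    from bounded_bilinear.has_vector_derivative[OF bounded_bilinear_inner this this]
    have "((\<lambda>t. (x t - y t) \<bullet> (x t - y t)) has_real_derivative (2 * (d \<bullet> e))) (at r)"
      by (simp add: d_def inner_commute has_real_derivative_iff_has_vector_derivative)
    then have "(N has_real_derivative
        2 * (d \<bullet> e) * exp (- 2 * L * r) + (exp (- 2 * L * r) * (- 2 * L)) * (d \<bullet> d)) (at r)"
      unfolding N_def d_def by (auto intro!: derivative_eq_intros)
    then have D: "(N has_real_derivative 2 * exp (- 2 * L * r) * (d \<bullet> e - L * (d \<bullet> d))) (at r)"
      by (simp add: algebra_simps)
    have "norm e \<le> L * norm d"
      using lipschitz_onD[OF L, of "x r" "y r"] x y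
      by (simp add: solution_in_def e_def d_def dist_norm)
    then have "d \<bullet> e \<le> norm d * (L * norm d)"
      by (meson mult_left_mono norm_cauchy_schwarz norm_ge_zero order_trans)
    then have "d \<bullet> e - L * (d \<bullet> d) \<le> 0"
      by (simp add: dot_square_norm power2_eq_square algebra_simps)
    then have "2 * exp (- 2 * L * r) * (d \<bullet> e - L * (d \<bullet> d)) \<le> 0"
      by (simp add: mult_nonneg_nonpos)
    with D show "\<exists>l. (N has_real_derivative l) (at r) \<and> l \<le> 0" by blast
  qed
  then have "(norm (x t - y t))\<^sup>2 * exp (- 2 * L * t) \<le> (norm (x 0 - y 0))\<^sup>2"
    by (simp add: N_def dot_square_norm)
  then have "(norm (x t - y t))\<^sup>2 \<le> (exp (L * t) * norm (x 0 - y 0))\<^sup>2"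
    by (simp add: exp_minus field_simps power_mult_distrib flip: exp_double)
  then show ?thesis by (rule power2_le_imp_le) simp
qed

lemma lipschitz_on_uminus_comp:
  fixes X :: "'a::metric_space \<Rightarrow> 'b::real_normed_vector"
  shows "L-lipschitz_on M X \<Longrightarrow> L-lipschitz_on M (\<lambda>z. - X z)"
  by (simp add: lipschitz_on_def dist_minus)

lemma gronwall:
  fixes X :: "'a::real_inner \<Rightarrow> 'a"
  assumes "solution_in X M x" "solution_in X M y" "L-lipschitz_on M X"
  shows "norm (x t - y t) \<le> exp (L * \<bar>t\<bar>) * norm (x 0 - y 0)"
proof (cases "0 \<le> t")
  case True
  then show ?thesis using gronwall_forward[OF assms] by simp
next
  case False
  then show ?thesis
    using gronwall_forward[OF assms(1,2)[THEN solution_in_reverse]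
        lipschitz_on_uminus_comp[OF assms(3)], of "- t"] by simp
qed

text \<open>Gronwall's bound for the two solutions shifted to a common starting time. The separate
  times \<open>s\<close> and \<open>r\<close> allow orbits that meet at different times to be
  identified.\<close>

lemma solution_in_unique:
  fixes X :: "'a::real_inner \<Rightarrow> 'a"
  assumes "solution_in X M x" "solution_in X M y" "L-lipschitz_on M X" "x s = y r"
  shows "x (s + t) = y (r + t)"
proof -
  have "norm (x (t + s) - y (t + r)) \<le> exp (L * \<bar>t\<bar>) * norm (x (0 + s) - y (0 + r))"
    by (rule gronwall[OF solution_in_shift[OF assms(1)] solution_in_shift[OF assms(2)] assms(3)])
  with assms(4) show ?thesis by (simp add: add.commute)
qed

section \<open>Existence of solutions for all times\<close>

lemma continuous_antiderivative_exists:
  fixes f :: "real \<Rightarrow> 'a::banach"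
  assumes "continuous_on UNIV f"
  shows "\<exists>g. g 0 = 0 \<and> (\<forall>t. (g has_vector_derivative f t) (at t))"
proof -
  \<comment> \<open>One of the two integrals is always 0, so this is the oriented integral from 0 to
    \<open>t\<close>.\<close>
  define g where "g t = integral {0..t} f - integral {t..0} f" for t
  have int: "f integrable_on {a..b}" for a b
    using assms by (intro integrable_continuous_real) (auto intro: continuous_on_subset)
  have "(g has_vector_derivative f t) (at t)" for t
  proof -
  define N :: real where "N = \<bar>t\<bar> + 1"
  have eq: "integral {-N..u} f - integral {-N..0} f = g u" if "u \<in> {-N<..<N}" for u
  proof (cases "0 \<le> u")
    case True
    then show ?thesis
      using Henstock_Kurzweil_Integration.integral_combine[of "-N" 0 u f] int
      by (cases "u = 0") (auto simp: N_def g_def algebra_simps)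
  next
    case False
    then show ?thesis
      using Henstock_Kurzweil_Integration.integral_combine[of "-N" u 0 f] int that
      by (auto simp: N_def g_def algebra_simps)
  qed
  have t: "t \<in> {-N<..<N}" by (auto simp: N_def)
  have "((\<lambda>u. integral {-N..u} f) has_vector_derivative f t) (at t within {-N..N})"
    using assms t by (intro integral_has_vector_derivative) (auto intro: continuous_on_subset)
  then have "((\<lambda>u. integral {-N..u} f) has_vector_derivative f t) (at t)"
    using t by (metis at_within_Icc_at greaterThanLessThan_iff)
  then have "((\<lambda>u. integral {-N..u} f - integral {-N..0} f) has_vector_derivative f t) (at t)"
    by (auto intro!: derivative_eq_intros)
  then show ?thesis
    by (rule has_vector_derivative_transform_within_open[OF _ open_greaterThanLessThan t eq])
  qed
  moreover have "g 0 = 0" by (simp add: g_def)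
  ultimately show ?thesis by blast
qed

text \<open>The mean value bound in both time directions: negative times follow by reflecting
  \<open>g\<close>, since the bound on \<open>f\<close> is even in \<open>t\<close>. Picard
  iteration uses it with a linear and with an exponential \<open>\<phi>\<close>.\<close>

lemma norm_antiderivative_le:
  fixes g :: "real \<Rightarrow> 'a::real_normed_vector"
  assumes g: "\<And>t. (g has_vector_derivative f t) (at t)" "g 0 = 0"
    and \<phi>: "\<And>t. (\<phi> has_real_derivative \<phi>' t) (at t)"
    and le: "\<And>t. norm (f t) \<le> \<phi>' \<bar>t\<bar>"
  shows "norm (g t) \<le> \<phi> \<bar>t\<bar> - \<phi> 0"
proof -
  have pos: "norm (h t) \<le> \<phi> t - \<phi> 0"
    if h: "\<And>t. (h has_vector_derivative k t) (at t)" "h 0 = 0"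
      "\<And>t. norm (k t) \<le> \<phi>' \<bar>t\<bar>" and t: "t > 0" for h :: "real \<Rightarrow> 'a" and k t
  proof -
    have "norm (h t - h 0) \<le> \<phi> t - \<phi> 0"
    proof (rule differentiable_bound_general[where f'=k and \<phi>'=\<phi>'])
      show "continuous_on {0..t} h"
        by (meson continuous_at_imp_continuous_on h(1) has_vector_derivative_continuous)
      show "continuous_on {0..t} \<phi>"
        by (meson DERIV_continuous_on \<phi> has_field_derivative_at_within)
      show "norm (k x) \<le> \<phi>' x" if "0 < x" "x < t" for x
        using h(3)[of x] that by simp
    qed (use h t \<phi> in \<open>auto simp: has_real_derivative_iff_has_vector_derivative\<close>)
    with h(2) show ?thesis by simp
  qed
  consider "t = 0" | "t > 0" | "t < 0" by linarith
  then show ?thesis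
  proof cases
    case 3
    have "((\<lambda>t. g (- t)) has_vector_derivative - f (- t)) (at t)" for t
      using vector_diff_chain_at[of uminus "-1" t g "f (- t)"] g(1)[of "- t"]
      by (simp add: o_def has_vector_derivative_minus[OF has_vector_derivative_id])
    moreover have "norm (- f (- t)) \<le> \<phi>' \<bar>t\<bar>" for t
      using le[of "- t"] by simp
    ultimately have "norm (g (- (- t))) \<le> \<phi> (- t) - \<phi> 0"
      using 3 g(2) by (intro pos[where h="\<lambda>t. g (- t)"]) auto
    with 3 show ?thesis by simp
  qed (use pos[OF g le] g(2) in auto)
qed

text \<open>Picard iteration for all times at once: in the unknown \<open>exp (- K * \<bar>t\<bar>) *\<^sub>R (x t - p)\<close>, a
  bounded function, the integral operator is a contraction as soon as \<open>K\<close> is twice the Lipschitz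
  constant.\<close>

lemma global_solution_exists:
  fixes F :: "'a::banach \<Rightarrow> 'a"
  assumes lip: "L-lipschitz_on UNIV F" and bdd: "\<And>p. norm (F p) \<le> C"
  shows "\<exists>x. solution_in F UNIV x \<and> x 0 = p"
proof -
  define K where "K = 2 * (L + 1)"
  have L: "0 \<le> L" using lip by (rule lipschitz_on_nonneg)
  then have K: "K > 0" by (simp add: K_def)
  have contF: "continuous_on UNIV F" using lip by (rule lipschitz_on_continuous_on)
  \<comment> \<open>The velocity along the curve that the weighted unknown \<open>y\<close>
    encodes.\<close>
  define f where "f y t = F (p + exp (K * \<bar>t\<bar>) *\<^sub>R apply_bcontfun y t)" for y t
  have contf: "continuous_on UNIV (f y)" for y
    unfolding f_def
    by (intro continuous_on_compose2[OF contF] continuous_intros continuous_on_apply_bcontfun) auto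
  obtain G where G0: "\<And>y. G y 0 = 0"
    and GD: "\<And>y t. (G y has_vector_derivative f y t) (at t)"
    using continuous_antiderivative_exists[OF contf] by metis
  define T where "T y t = exp (- (K * \<bar>t\<bar>)) *\<^sub>R G y t" for y t
  have T_bcontfun: "T y \<in> bcontfun" for y
  proof (rule bcontfun_normI)
    have "continuous_on UNIV (G y)"
      by (meson continuous_at_imp_continuous_on GD has_vector_derivative_continuous)
    then show "continuous_on UNIV (T y)"
      unfolding T_def by (intro continuous_intros)
    fix t
    have "norm (G y t) \<le> C * \<bar>t\<bar> - C * 0"
      by (rule norm_antiderivative_le[OF GD G0, where \<phi>'="\<lambda>_. C"])
        (auto intro!: derivative_eq_intros simp: f_def bdd)
    \<comment> \<open>Bounded speed gives at most linear growth, which the exponential weight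
      absorbs.\<close>
    also have "\<dots> \<le> C / K * exp (K * \<bar>t\<bar>)"
    proof -
      have "C \<ge> 0" using bdd[of 0] norm_ge_zero order_trans by blast
      have "K * \<bar>t\<bar> \<le> exp (K * \<bar>t\<bar>)"
        using exp_ge_add_one_self[of "K * \<bar>t\<bar>"] by linarith
      with \<open>C \<ge> 0\<close> have "C * (K * \<bar>t\<bar>) \<le> C * exp (K * \<bar>t\<bar>)"
        by (intro mult_left_mono)
      then show ?thesis using K by (simp add: field_simps)
    qed
    finally show "norm (T y t) \<le> C / K"
      by (simp add: T_def exp_minus field_simps)
  qed
  have contraction: "dist (T y t) (T z t) \<le> 1 / 2 * dist y z" for y z t
  proof -
    define d where "d = dist y z"
    \<comment> \<open>Integrating the Lipschitz bound gives the factor \<open>(L + 1) / K\<close>,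
      which is one half.\<close>
    have "norm (G y t - G z t) \<le> d / 2 * exp (K * \<bar>t\<bar>) - d / 2 * exp (K * 0)"
    proof (rule norm_antiderivative_le[where g="\<lambda>t. G y t - G z t"
          and \<phi>="\<lambda>t. d / 2 * exp (K * t)" and \<phi>'="\<lambda>t. (L + 1) * d * exp (K * t)"])
      show "((\<lambda>t. G y t - G z t) has_vector_derivative f y t - f z t) (at t)" for t
        by (intro derivative_intros GD)
      show "((\<lambda>t. d / 2 * exp (K * t)) has_real_derivative (L + 1) * d * exp (K * t)) (at t)" for t
        by (auto intro!: derivative_eq_intros simp: K_def)
      fix t
      have "dist (f y t) (f z t) \<le> L * dist (p + exp (K * \<bar>t\<bar>) *\<^sub>R apply_bcontfun y t)
          (p + exp (K * \<bar>t\<bar>) *\<^sub>R apply_bcontfun z t)"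
        unfolding f_def by (intro lipschitz_onD[OF lip]) auto
      also have "\<dots> = L * (exp (K * \<bar>t\<bar>) * dist (apply_bcontfun y t) (apply_bcontfun z t))"
        by (simp add: dist_norm flip: scaleR_diff_right)
      also have "\<dots> \<le> (L + 1) * (exp (K * \<bar>t\<bar>) * d)"
        unfolding d_def using L by (intro mult_mono dist_bounded) auto
      finally show "norm (f y t - f z t) \<le> (L + 1) * d * exp (K * \<bar>t\<bar>)"
        by (simp add: dist_norm mult_ac)
    qed (simp add: G0)
    also have "\<dots> \<le> d / 2 * exp (K * \<bar>t\<bar>)" by (simp add: d_def)
    finally have "norm (G y t - G z t) \<le> d / 2 * exp (K * \<bar>t\<bar>)" .
    moreover have "dist (T y t) (T z t) = exp (- (K * \<bar>t\<bar>)) * norm (G y t - G z t)"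
      by (simp add: T_def dist_norm flip: scaleR_diff_right)
    ultimately have "dist (T y t) (T z t) \<le> exp (- (K * \<bar>t\<bar>)) * (d / 2 * exp (K * \<bar>t\<bar>))"
      by simp
    also have "\<dots> = d / 2" by (simp add: exp_minus)
    finally show ?thesis by (simp add: d_def)
  qed
  have "\<exists>!y. Bcontfun (T y) = y"
  proof (rule banach_fix_type[of "1/2"])
    show "\<forall>y z. dist (Bcontfun (T y)) (Bcontfun (T z)) \<le> 1 / 2 * dist y z"
      by (intro allI dist_bound) (simp only: Bcontfun_inverse[OF T_bcontfun] contraction)
  qed simp_all
  then obtain y where "Bcontfun (T y) = y" by blast
  then have y: "apply_bcontfun y t = T y t" for t
    using Bcontfun_inverse[OF T_bcontfun] by metis
  have "f y t = F (p + G y t)" for t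
    by (simp add: f_def y T_def exp_minus)
  with GD have "((\<lambda>t. p + G y t) has_vector_derivative F (p + G y t)) (at t)" for t
    by (auto intro!: derivative_eq_intros)
  then show ?thesis
    by (intro exI[of _ "\<lambda>t. p + G y t"]) (auto simp: solution_in_def G0)
qed

subsection \<open>Orbits tending to a cusp\<close>

text \<open>Reversing time in the model \<open>u' = u\<close>, \<open>v' = - v\<close> amounts to
  exchanging \<open>u\<close> and \<open>v\<close>.\<close>

lemma hyperbolic_sector_reverse:
  assumes "hyperbolic_sector X M p h S"
  shows "hyperbolic_sector (\<lambda>z. - X z) M p (h \<circ> prod.swap) S"
proof -
  obtain g where g: "homeomorphism model_sector S h g" and h0: "h (0, 0) = p"
    and arcs: "\<And>q. q \<in> model_sector - {(0, 0)} \<Longrightarrow> \<exists>x \<tau>. solution_in X M x \<and>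
       strict_mono_on {t. saddle_flow t q \<in> model_sector} \<tau> \<and>
       (\<forall>t. saddle_flow t q \<in> model_sector \<longrightarrow> h (saddle_flow t q) = x (\<tau> t))"
    using assms unfolding hyperbolic_sector_def by blast
  have "homeomorphism model_sector model_sector prod.swap prod.swap"
    by (rule homeomorphismI) (auto simp: model_sector_def intro!: continuous_on_swap)
  then have "homeomorphism model_sector S (h \<circ> prod.swap) (prod.swap \<circ> g)"
    using g by (rule homeomorphism_compose)
  moreover have "\<exists>x \<tau>. solution_in (\<lambda>z. - X z) M x \<and>
       strict_mono_on {t. saddle_flow t q \<in> model_sector} \<tau> \<and>
       (\<forall>t. saddle_flow t q \<in> model_sector \<longrightarrow> (h \<circ> prod.swap) (saddle_flow t q) = x (\<tau> t))"
    if q: "q \<in> model_sector - {(0, 0)}" for q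
  proof -
    have flow: "saddle_flow t q = prod.swap (saddle_flow (- t) (prod.swap q))" for t
      by (simp add: saddle_flow_def)
    have swap: "prod.swap r \<in> model_sector \<longleftrightarrow> r \<in> model_sector" for r
      by (cases r) (auto simp: model_sector_def)
    have "prod.swap q \<in> model_sector - {(0, 0)}"
      using q by (cases q) (auto simp: model_sector_def)
    from arcs[OF this] obtain x \<tau> where x: "solution_in X M x"
      and \<tau>: "strict_mono_on {t. saddle_flow t (prod.swap q) \<in> model_sector} \<tau>"
      and eq: "\<And>t. saddle_flow t (prod.swap q) \<in> model_sector \<Longrightarrow>
        h (saddle_flow t (prod.swap q)) = x (\<tau> t)" by blast
    show ?thesis
    proof (intro exI conjI allI impI)
      show "solution_in (\<lambda>z. - X z) M (\<lambda>t. x (- t))" using x by (rule solution_in_reverse)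
      show "strict_mono_on {t. saddle_flow t q \<in> model_sector} (\<lambda>t. - \<tau> (- t))"
        using \<tau> unfolding flow swap strict_mono_on_def by simp
      fix t assume "saddle_flow t q \<in> model_sector"
      then show "(h \<circ> prod.swap) (saddle_flow t q) = x (- (- \<tau> (- t)))"
        using eq[of "- t"] unfolding flow swap by simp
    qed
  qed
  ultimately show ?thesis
    using h0 unfolding hyperbolic_sector_def by auto
qed

lemma cuspE:
  assumes "cusp X M p"
  obtains h1 S1 h2 S2 U where "p \<in> M" "X p = 0"
    "hyperbolic_sector X M p h1 S1" "hyperbolic_sector X M p h2 S2"
    "h1 ` model_incoming = h2 ` model_incoming" "h1 ` model_outgoing = h2 ` model_outgoing"
    "S1 \<inter> S2 = h1 ` model_incoming \<union> h1 ` model_outgoing"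
    "openin (top_of_set M) U" "p \<in> U" "U \<subseteq> S1 \<union> S2"
  using assms unfolding cusp_def by (elim conjE exE) (rule that)

text \<open>Under time reversal the two separatrices trade places. This transfers statements on
  orbits tending to the cusp to orbits leaving it.\<close>

lemma cusp_reverse:
  assumes "cusp X M p"
  shows "cusp (\<lambda>z. - X z) M p"
proof -
  obtain h1 S1 h2 S2 U where h:
    "hyperbolic_sector X M p h1 S1" "hyperbolic_sector X M p h2 S2"
    "h1 ` model_incoming = h2 ` model_incoming" "h1 ` model_outgoing = h2 ` model_outgoing"
    "S1 \<inter> S2 = h1 ` model_incoming \<union> h1 ` model_outgoing"
    and U: "openin (top_of_set M) U" "p \<in> U" "U \<subseteq> S1 \<union> S2" and p: "p \<in> M" "X p = 0"
    using assms by (rule cuspE)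
  have "prod.swap ` model_incoming = model_outgoing" "prod.swap ` model_outgoing = model_incoming"
    by (auto simp: model_incoming_def model_outgoing_def image_iff)
  then have swap: "(f \<circ> prod.swap) ` model_incoming = f ` model_outgoing"
    "(f \<circ> prod.swap) ` model_outgoing = f ` model_incoming" for f :: "real \<times> real \<Rightarrow> 'a"
    by (metis image_comp)+
  show ?thesis
    unfolding cusp_def
  proof (intro conjI exI)
    show "hyperbolic_sector (\<lambda>z. - X z) M p (h1 \<circ> prod.swap) S1"
      "hyperbolic_sector (\<lambda>z. - X z) M p (h2 \<circ> prod.swap) S2"
      using h(1,2) by (auto intro: hyperbolic_sector_reverse)
    show "S1 \<inter> S2 = (h1 \<circ> prod.swap) ` model_incoming \<union> (h1 \<circ> prod.swap) ` model_outgoing"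
      unfolding swap h(5) by (rule Un_commute)
    show "openin (top_of_set M) U" "p \<in> U" "U \<subseteq> S1 \<union> S2" by (fact U)+
  qed (use h(3,4) p in \<open>simp_all only: swap, simp_all\<close>)
qed

text \<open>Inside a sector, every orbit off the incoming side leaves through the edge opposite to it,
  which stays away from the vertex.\<close>

lemma hyperbolic_sector_incoming:
  fixes X :: "'a::real_inner \<Rightarrow> 'a"
  assumes sector: "hyperbolic_sector X M p h S" and lip: "L-lipschitz_on M X"
    and x: "solution_in X M x" and lim: "(x \<longlongrightarrow> p) at_top"
  shows "\<forall>\<^sub>F t in at_top. x t \<in> S \<and> x t \<noteq> p \<longrightarrow> x t \<in> h ` model_incoming"
proof -
  obtain g where g: "homeomorphism model_sector S h g" and h0: "h (0, 0) = p"
    and arcs: "\<And>q. q \<in> model_sector - {(0, 0)} \<Longrightarrow> \<exists>x \<tau>. solution_in X M x \<and>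
       strict_mono_on {t. saddle_flow t q \<in> model_sector} \<tau> \<and>
       (\<forall>t. saddle_flow t q \<in> model_sector \<longrightarrow> h (saddle_flow t q) = x (\<tau> t))"
    using sector unfolding hyperbolic_sector_def by blast
  \<comment> \<open>The edge \<open>u = 1\<close>, where the model orbits with \<open>u > 0\<close>
    leave the sector.\<close>
  define E :: "(real \<times> real) set" where "E = {1} \<times> {0..1}"
  have E: "E \<subseteq> model_sector" "(0, 0) \<notin> E" by (auto simp: E_def model_sector_def)
  have "compact E" unfolding E_def by (intro compact_Times) auto
  then have "closed (h ` E)"
    using g E(1) by (meson compact_continuous_image compact_imp_closed continuous_on_subset
        homeomorphism_cont1)
  moreover have "p \<notin> h ` E"
  proof
    assume "p \<in> h ` E"
    then obtain e where "e \<in> E" "h e = h (0, 0)" using h0 by auto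
    then have "e = (0, 0)"
      using homeomorphism_apply1[OF g, of e] homeomorphism_apply1[OF g, of "(0, 0)"] E(1)
      by (auto simp: model_sector_def)
    with \<open>e \<in> E\<close> E(2) show False by simp
  qed
  \<comment> \<open>The image of the edge is closed and misses \<open>p\<close>, so an orbit tending
    to \<open>p\<close> avoids it from some time on.\<close>
  ultimately have "\<forall>\<^sub>F t in at_top. x t \<in> - (h ` E)"
    by (intro topological_tendstoD[OF lim]) auto
  then obtain T where T: "\<And>t. t \<ge> T \<Longrightarrow> x t \<notin> h ` E"
    by (auto simp: eventually_at_top_linorder)
  have "x t \<in> h ` model_incoming" if "t \<ge> T" "x t \<in> S" "x t \<noteq> p" for t
  proof -
    have "x t \<in> h ` model_sector" using that(2) g by (simp add: homeomorphism_image1)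
    then obtain u v where uv: "(u, v) \<in> model_sector" "x t = h (u, v)" by auto
    have "u = 0"
    proof (rule ccontr)
      assume "u \<noteq> 0"
      with uv have u: "0 < u" "u \<le> 1" and v: "0 \<le> v" "v \<le> 1" by (auto simp: model_sector_def)
      obtain y \<tau> where y: "solution_in X M y"
        and \<tau>: "strict_mono_on {t. saddle_flow t (u, v) \<in> model_sector} \<tau>"
        and eq: "\<And>t. saddle_flow t (u, v) \<in> model_sector \<Longrightarrow> h (saddle_flow t (u, v)) = y (\<tau> t)"
        using arcs[of "(u, v)"] uv(1) u by auto
      \<comment> \<open>The time the model orbit needs from \<open>u\<close> to the edge. Since
        \<open>\<tau>\<close> is increasing, \<open>x\<close> meets the edge at time
        \<open>t\<close> or later.\<close>
      define r where "r = - ln u"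
      have r: "r \<ge> 0" using u by (simp add: r_def)
      have start: "saddle_flow 0 (u, v) = (u, v)" by (simp add: saddle_flow_def)
      have exit: "saddle_flow r (u, v) = (1, u * v)"
        using u by (simp add: saddle_flow_def r_def exp_minus)
      have uvE: "(1, u * v) \<in> E"
        using u v by (simp add: E_def mult_le_one)
      have "\<tau> 0 \<le> \<tau> r"
        using strict_mono_onD[OF \<tau>, of 0 r] r uv(1) uvE E(1)
        by (cases "r = 0") (auto simp: start exit)
      moreover have "x t = y (\<tau> 0)"
        using eq[of 0] uv by (simp add: start)
      then have "x (t + (\<tau> r - \<tau> 0)) = y (\<tau> 0 + (\<tau> r - \<tau> 0))"
        by (rule solution_in_unique[OF x y lip])
      then have "x (t + (\<tau> r - \<tau> 0)) = h (1, u * v)"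
        using eq[of r] uvE E(1) by (auto simp: exit)
      ultimately show False
        using T[of "t + (\<tau> r - \<tau> 0)"] uvE \<open>t \<ge> T\<close> by auto
    qed
    with uv show ?thesis by (auto simp: model_incoming_def model_sector_def)
  qed
  then show ?thesis by (auto simp: eventually_at_top_linorder)
qed

text \<open>The incoming side without the vertex is a single orbit descending to the vertex, so a
  solution at height \<open>v\<close> goes on through every lower height; \<open>ln (v / w)\<close>
  is the travel time in the model.\<close>

lemma hyperbolic_sector_incoming_meet:
  fixes X :: "'a::real_inner \<Rightarrow> 'a"
  assumes sector: "hyperbolic_sector X M p h S" and lip: "L-lipschitz_on M X"
    and x: "solution_in X M x" and q: "x t = h (0, v)" and v: "0 < w" "w \<le> v" "v \<le> 1"
  shows "\<exists>s\<ge>t. x s = h (0, w)"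
proof -
  have "(0, v) \<in> model_sector - {(0, 0)}" using v by (auto simp: model_sector_def)
  then obtain y \<tau> where y: "solution_in X M y"
    and \<tau>: "strict_mono_on {t. saddle_flow t (0, v) \<in> model_sector} \<tau>"
    and eq: "\<And>t. saddle_flow t (0, v) \<in> model_sector \<Longrightarrow> h (saddle_flow t (0, v)) = y (\<tau> t)"
    using sector unfolding hyperbolic_sector_def by blast
  define r where "r = ln (v / w)"
  have r: "r \<ge> 0" using v by (simp add: r_def)
  have start: "saddle_flow 0 (0, v) = (0, v)" by (simp add: saddle_flow_def)
  have stop: "saddle_flow r (0, v) = (0, w)"
    using v by (simp add: saddle_flow_def r_def exp_minus)
  have "\<tau> 0 \<le> \<tau> r"
    using strict_mono_onD[OF \<tau>, of 0 r] r v
    by (cases "r = 0") (auto simp: start stop model_sector_def)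
  moreover have "x t = y (\<tau> 0)"
    using eq[of 0] q v by (simp add: start model_sector_def)
  then have "x (t + (\<tau> r - \<tau> 0)) = y (\<tau> 0 + (\<tau> r - \<tau> 0))"
    by (rule solution_in_unique[OF x y lip])
  then have "x (t + (\<tau> r - \<tau> 0)) = h (0, w)"
    using eq[of r] v by (simp add: stop model_sector_def)
  ultimately show ?thesis by (intro exI[of _ "t + (\<tau> r - \<tau> 0)"]) auto
qed

text \<open>Both solutions end up on the incoming separatrix that the two sectors share. It is one
  orbit, so they meet at the lower of two heights reached there. The bound \<open>a\<close> places
  the meeting as late as desired.\<close>

lemma cusp_incoming_unique:
  fixes X :: "'a::real_inner \<Rightarrow> 'a"
  assumes cusp: "cusp X M p" and lip: "L-lipschitz_on M X"
    and x: "solution_in X M x" "(x \<longlongrightarrow> p) at_top" "\<forall>\<^sub>F t in at_top. x t \<noteq> p"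
    and y: "solution_in X M y" "(y \<longlongrightarrow> p) at_top" "\<forall>\<^sub>F t in at_top. y t \<noteq> p"
  shows "\<exists>s\<ge>a. \<exists>r\<ge>a. x s = y r"
proof -
  obtain h S1 h2 S2 U where h: "hyperbolic_sector X M p h S1" "hyperbolic_sector X M p h2 S2"
    "h ` model_incoming = h2 ` model_incoming"
    and U: "openin (top_of_set M) U" "p \<in> U" "U \<subseteq> S1 \<union> S2"
    using cusp by (rule cuspE)
  have h0: "h (0, 0) = p" using h(1) by (simp add: hyperbolic_sector_def)
  have incoming: "\<forall>\<^sub>F t in at_top. z t \<in> h ` model_incoming"
    if z: "solution_in X M z" "(z \<longlongrightarrow> p) at_top" "\<forall>\<^sub>F t in at_top. z t \<noteq> p" for z
  proof -
    obtain V where V: "open V" "U = M \<inter> V" using U(1) by (auto simp: openin_open)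
    then have "\<forall>\<^sub>F t in at_top. z t \<in> V"
      using U(2) by (intro topological_tendstoD[OF z(2)]) auto
    then have "\<forall>\<^sub>F t in at_top. z t \<in> S1 \<union> S2"
      by eventually_elim (use z(1) U(3) V in \<open>auto simp: solution_in_def\<close>)
    then show ?thesis
      using hyperbolic_sector_incoming[OF h(1) lip z(1,2)]
        hyperbolic_sector_incoming[OF h(2) lip z(1,2)] z(3)
      by eventually_elim (use h(3) in auto)
  qed
  have "\<exists>t\<ge>a. \<exists>v. 0 < v \<and> v \<le> 1 \<and> z t = h (0, v)"
    if z: "solution_in X M z" "(z \<longlongrightarrow> p) at_top" "\<forall>\<^sub>F t in at_top. z t \<noteq> p" for z
  proof -
    have "\<forall>\<^sub>F t in at_top. t \<ge> a \<and> z t \<in> h ` model_incoming \<and> z t \<noteq> p"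
      by (intro eventually_conj eventually_ge_at_top incoming[OF z] z(3))
    then obtain t where "t \<ge> a" "z t \<in> h ` model_incoming" "z t \<noteq> p"
      using eventually_happens'[OF trivial_limit_at_top_linorder] by blast
    moreover from this obtain v where "0 \<le> v" "v \<le> 1" "z t = h (0, v)"
      by (auto simp: model_incoming_def)
    moreover have "v \<noteq> 0" using \<open>z t \<noteq> p\<close> h0 \<open>z t = h (0, v)\<close> by auto
    ultimately show ?thesis by (intro exI[of _ t] conjI exI[of _ v]) auto
  qed
  from this[OF x] this[OF y] obtain t v t' v' where
    x_at: "t \<ge> a" "0 < v" "v \<le> 1" "x t = h (0, v)" and
    y_at: "t' \<ge> a" "0 < v'" "v' \<le> 1" "y t' = h (0, v')"
    by blast
  show ?thesis
  proof (cases "v' \<le> v")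
    case True
    then obtain s where "s \<ge> t" "x s = h (0, v')"
      using hyperbolic_sector_incoming_meet[OF h(1) lip x(1) x_at(4)] x_at y_at by blast
    with x_at y_at show ?thesis by (intro exI[of _ s] conjI exI[of _ t']) auto
  next
    case False
    then obtain s where "s \<ge> t'" "y s = h (0, v)"
      using hyperbolic_sector_incoming_meet[OF h(1) lip y(1) y_at(4), of v] x_at y_at by auto
    with x_at y_at show ?thesis by (intro exI[of _ t] conjI exI[of _ s]) auto
  qed
qed

subsection \<open>Bounded Lipschitz functions\<close>

text \<open>Boundedness is included because it makes the class closed under products; polynomials in
  sines, cosines or bounded coordinates are then covered by \<open>bl_intros\<close>.\<close>

definition bounded_lipschitz_on :: "'a::metric_space set \<Rightarrow> ('a \<Rightarrow> real) \<Rightarrow> bool" where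
  "bounded_lipschitz_on S f \<longleftrightarrow> (\<exists>C. \<forall>x\<in>S. \<bar>f x\<bar> \<le> C) \<and> (\<exists>L. L-lipschitz_on S f)"

named_theorems bl_intros

lemma bounded_lipschitz_onI:
  assumes "\<And>x. x \<in> S \<Longrightarrow> \<bar>f x\<bar> \<le> C" "\<And>x y. x \<in> S \<Longrightarrow> y \<in> S \<Longrightarrow> \<bar>f x - f y\<bar> \<le> L * dist x y"
  shows "bounded_lipschitz_on S f"
proof -
  have "\<bar>L\<bar>-lipschitz_on S f"
  proof (rule lipschitz_onI)
    fix x y assume "x \<in> S" "y \<in> S"
    then have "\<bar>f x - f y\<bar> \<le> L * dist x y" by (rule assms(2))
    also have "\<dots> \<le> \<bar>L\<bar> * dist x y" by (intro mult_right_mono) auto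
    finally show "dist (f x) (f y) \<le> \<bar>L\<bar> * dist x y" by (simp add: dist_real_def)
  qed simp
  with assms(1) show ?thesis unfolding bounded_lipschitz_on_def by blast
qed

lemma bounded_lipschitz_onE:
  assumes "bounded_lipschitz_on S f"
  obtains C L where "0 \<le> C" "0 \<le> L" "\<And>x. x \<in> S \<Longrightarrow> \<bar>f x\<bar> \<le> C"
    "\<And>x y. x \<in> S \<Longrightarrow> y \<in> S \<Longrightarrow> \<bar>f x - f y\<bar> \<le> L * dist x y"
proof -
  obtain C L where C: "\<And>x. x \<in> S \<Longrightarrow> \<bar>f x\<bar> \<le> C" and L: "L-lipschitz_on S f"
    using assms unfolding bounded_lipschitz_on_def by auto
  show thesis
  proof (rule that)
    show "0 \<le> \<bar>C\<bar>" "0 \<le> L" using lipschitz_on_nonneg[OF L] by auto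
    show "\<bar>f x\<bar> \<le> \<bar>C\<bar>" if "x \<in> S" for x using C[OF that] by linarith
    show "\<bar>f x - f y\<bar> \<le> L * dist x y" if "x \<in> S" "y \<in> S" for x y
      using lipschitz_onD[OF L that] by (simp add: dist_real_def)
  qed
qed

lemma bounded_lipschitz_on_const [bl_intros]: "bounded_lipschitz_on S (\<lambda>x. c)"
  by (rule bounded_lipschitz_onI[of _ _ "\<bar>c\<bar>" 0]) auto

lemma bounded_lipschitz_on_add [bl_intros]:
  assumes "bounded_lipschitz_on S f" "bounded_lipschitz_on S g"
  shows "bounded_lipschitz_on S (\<lambda>x. f x + g x)"
proof -
  obtain C L where "0 \<le> C" "0 \<le> L" and f: "\<And>x. x \<in> S \<Longrightarrow> \<bar>f x\<bar> \<le> C"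
    "\<And>x y. x \<in> S \<Longrightarrow> y \<in> S \<Longrightarrow> \<bar>f x - f y\<bar> \<le> L * dist x y"
    by (rule bounded_lipschitz_onE[OF assms(1)]) (blast intro: that)
  obtain D K where "0 \<le> D" "0 \<le> K" and g: "\<And>x. x \<in> S \<Longrightarrow> \<bar>g x\<bar> \<le> D"
    "\<And>x y. x \<in> S \<Longrightarrow> y \<in> S \<Longrightarrow> \<bar>g x - g y\<bar> \<le> K * dist x y"
    by (rule bounded_lipschitz_onE[OF assms(2)]) (blast intro: that)
  show ?thesis
  proof (rule bounded_lipschitz_onI)
    show "\<bar>f x + g x\<bar> \<le> C + D" if "x \<in> S" for x
      using f(1)[OF that] g(1)[OF that] by linarith
    show "\<bar>f x + g x - (f y + g y)\<bar> \<le> (L + K) * dist x y" if "x \<in> S" "y \<in> S" for x y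
      using f(2)[OF that] g(2)[OF that] by (simp add: distrib_right)
  qed
qed

lemma bounded_lipschitz_on_mult [bl_intros]:
  assumes "bounded_lipschitz_on S f" "bounded_lipschitz_on S g"
  shows "bounded_lipschitz_on S (\<lambda>x. f x * g x)"
proof -
  obtain C L where C: "0 \<le> C" "0 \<le> L" and f: "\<And>x. x \<in> S \<Longrightarrow> \<bar>f x\<bar> \<le> C"
    "\<And>x y. x \<in> S \<Longrightarrow> y \<in> S \<Longrightarrow> \<bar>f x - f y\<bar> \<le> L * dist x y"
    by (rule bounded_lipschitz_onE[OF assms(1)]) (blast intro: that)
  obtain D K where D: "0 \<le> D" "0 \<le> K" and g: "\<And>x. x \<in> S \<Longrightarrow> \<bar>g x\<bar> \<le> D"
    "\<And>x y. x \<in> S \<Longrightarrow> y \<in> S \<Longrightarrow> \<bar>g x - g y\<bar> \<le> K * dist x y"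
    by (rule bounded_lipschitz_onE[OF assms(2)]) (blast intro: that)
  show ?thesis
  proof (rule bounded_lipschitz_onI)
    show "\<bar>f x * g x\<bar> \<le> C * D" if "x \<in> S" for x
      unfolding abs_mult using f(1)[OF that] g(1)[OF that] C by (intro mult_mono) auto
    fix x y assume xy: "x \<in> S" "y \<in> S"
    have "\<bar>f x * g x - f y * g y\<bar> = \<bar>f x * (g x - g y) + (f x - f y) * g y\<bar>"
      by (simp add: algebra_simps)
    also have "\<dots> \<le> \<bar>f x\<bar> * \<bar>g x - g y\<bar> + \<bar>f x - f y\<bar> * \<bar>g y\<bar>"
      by (metis abs_mult abs_triangle_ineq)
    also have "\<dots> \<le> C * (K * dist x y) + (L * dist x y) * D"
      using f(1)[OF xy(1)] g(1)[OF xy(2)] f(2)[OF xy] g(2)[OF xy] C D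
      by (intro add_mono mult_mono) auto
    finally show "\<bar>f x * g x - f y * g y\<bar> \<le> (C * K + L * D) * dist x y"
      by (simp add: algebra_simps)
  qed
qed

lemma bounded_lipschitz_on_minus [bl_intros]:
  "bounded_lipschitz_on S f \<Longrightarrow> bounded_lipschitz_on S (\<lambda>x. - f x)"
  using bounded_lipschitz_on_mult[OF bounded_lipschitz_on_const[of S "-1"], of f] by simp

lemma bounded_lipschitz_on_diff [bl_intros]:
  "bounded_lipschitz_on S f \<Longrightarrow> bounded_lipschitz_on S g \<Longrightarrow> bounded_lipschitz_on S (\<lambda>x. f x - g x)"
  using bounded_lipschitz_on_add[OF _ bounded_lipschitz_on_minus] by fastforce

lemma bounded_lipschitz_on_power [bl_intros]:
  "bounded_lipschitz_on S f \<Longrightarrow> bounded_lipschitz_on S (\<lambda>x. f x ^ n)"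
  by (induction n) (auto intro: bl_intros)

lemma bounded_lipschitz_on_compose:
  assumes f: "bounded_lipschitz_on UNIV f" and g: "K-lipschitz_on S g"
  shows "bounded_lipschitz_on S (\<lambda>x. f (g x))"
proof -
  obtain C L where C: "0 \<le> L" "\<And>x. \<bar>f x\<bar> \<le> C" "\<And>x y. \<bar>f x - f y\<bar> \<le> L * dist x y"
    using f by (rule bounded_lipschitz_onE) auto
  show ?thesis
  proof (rule bounded_lipschitz_onI)
    fix x y assume "x \<in> S" "y \<in> S"
    have "\<bar>f (g x) - f (g y)\<bar> \<le> L * dist (g x) (g y)" by (rule C)
    also have "\<dots> \<le> L * (K * dist x y)"
      using C(1) lipschitz_onD[OF g] \<open>x \<in> S\<close> \<open>y \<in> S\<close> by (intro mult_left_mono)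
    finally show "\<bar>f (g x) - f (g y)\<bar> \<le> L * K * dist x y" by simp
  qed (rule C)
qed

lemma bounded_lipschitz_on_real_DERIV:
  assumes "\<And>x. \<bar>f x\<bar> \<le> C" "\<And>x::real. (f has_real_derivative f' x) (at x)" "\<And>x. \<bar>f' x\<bar> \<le> L"
  shows "bounded_lipschitz_on UNIV f"
proof (rule bounded_lipschitz_onI)
  show "\<bar>f x - f y\<bar> \<le> L * dist x y" for x y
    using field_differentiable_bound[of UNIV f f' L x y] assms(2,3) by (simp add: dist_norm)
qed (rule assms(1))

lemma bounded_lipschitz_on_cos [bl_intros]: "bounded_lipschitz_on UNIV (\<lambda>x::real. cos x)"
  by (rule bounded_lipschitz_on_real_DERIV[where f'="\<lambda>x. - sin x" and C=1 and L=1])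
    (auto intro!: derivative_eq_intros)

lemma bounded_lipschitz_on_sin [bl_intros]: "bounded_lipschitz_on UNIV (\<lambda>x::real. sin x)"
  by (rule bounded_lipschitz_on_real_DERIV[where f'=cos and C=1 and L=1])
    (auto intro!: derivative_eq_intros)

text \<open>At the first zero after 0 the function would have to come down from positive values,
  against the positive slope there.\<close>

lemma pos_if_pos_derivative_at_zeros:
  fixes f :: "real \<Rightarrow> real"
  assumes der: "\<And>r. (f has_real_derivative f' r) (at r)" and "f 0 = 0" and "0 < t"
    and pos: "\<And>r. 0 \<le> r \<Longrightarrow> r \<le> t \<Longrightarrow> f r = 0 \<Longrightarrow> 0 < f' r"
  shows "0 < f t"
proof (rule ccontr)
  assume "\<not> 0 < f t"
  have cont: "continuous_on S f" for S
    by (meson DERIV_continuous_on der has_field_derivative_at_within)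
  obtain d where d: "d > 0" "\<And>h. 0 < h \<Longrightarrow> h < d \<Longrightarrow> 0 < f h"
    using DERIV_pos_inc_right[OF der pos, of 0] assms(2,3) by auto
  \<comment> \<open>Starting at \<open>d / 2\<close> leaves out the zero at 0 and makes the set
    compact.\<close>
  define Z where "Z = {r \<in> {d / 2..t}. f r \<le> 0}"
  have "d \<le> t" using d(2)[of t] \<open>0 < t\<close> \<open>\<not> 0 < f t\<close> by linarith
  then have "Z \<noteq> {}" using \<open>\<not> 0 < f t\<close> d(1) by (auto simp: Z_def intro!: exI[of _ t])
  moreover have "compact Z"
  proof -
    have "closed {r. f r \<le> 0}"
      using cont[of UNIV] by (intro closed_Collect_le continuous_on_const) auto
    then have "compact ({d / 2..t} \<inter> {r. f r \<le> 0})"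
      by (intro compact_Int_closed compact_Icc)
    then show ?thesis by (simp add: Z_def Int_def)
  qed
  ultimately obtain r where r: "r \<in> Z" "\<And>q. q \<in> Z \<Longrightarrow> r \<le> q"
    using compact_attains_inf by metis
  have before: "0 < f q" if "0 < q" "q < r" for q
    using r(2)[of q] d(2)[of q] that r(1) d(1) by (fastforce simp: Z_def)
  have "r > 0" using r(1) d(1) by (auto simp: Z_def)
  have "f r = 0"
  proof (rule ccontr)
    assume "f r \<noteq> 0"
    then have "f r < 0" using r(1) by (auto simp: Z_def)
    moreover have "0 < f (r / 2)" using before[of "r / 2"] \<open>r > 0\<close> by simp
    ultimately obtain q where "r / 2 \<le> q" "q \<le> r" "f q = 0"
      using IVT2'[of f r 0 "r / 2"] cont \<open>r > 0\<close> by fastforce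
    with before[of q] \<open>r > 0\<close> \<open>f r < 0\<close> show False by (cases "q = r") auto
  qed
  moreover have "0 \<le> r" "r \<le> t" using r(1) d(1) by (auto simp: Z_def)
  ultimately obtain e where e: "e > 0" "\<And>h. 0 < h \<Longrightarrow> h < e \<Longrightarrow> f (r - h) < 0"
    using DERIV_pos_inc_left[OF der pos, of r] by auto
  \<comment> \<open>Small enough for \<open>r - h\<close> to lie both between 0 and \<open>r\<close>
    and in the left neighbourhood of \<open>r\<close> where \<open>f\<close> is negative.\<close>
  define h where "h = min e r / 2"
  have "0 < h" "h < e" "h < r" using e(1) \<open>r > 0\<close> by (auto simp: h_def)
  with e(2)[of h] before[of "r - h"] show False by simp
qed

text \<open>The squared sine of the latitude, that is, the square of the third coordinate on the
  sphere, when \<open>w\<close> is the tangent of the latitude up to sign.\<close>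

definition lat :: "real \<Rightarrow> real" where
  "lat w = w\<^sup>2 / (1 + w\<^sup>2)"

lemma one_plus_square_pos [simp]: "0 < 1 + (w::real)\<^sup>2" "1 + (w::real)\<^sup>2 \<noteq> 0"
  by (smt (verit) zero_le_power2)+

lemma lat_0 [simp]: "lat 0 = 0" and lat_minus [simp]: "lat (- w) = lat w"
  and lat_nonneg [simp]: "0 \<le> lat w" and lat_less_1: "lat w < 1"
  and lat_pos: "w \<noteq> 0 \<Longrightarrow> 0 < lat w" and one_minus_lat: "1 - lat w = 1 / (1 + w\<^sup>2)"
  by (auto simp: lat_def field_simps)

lemma lat_mono: "0 \<le> v \<Longrightarrow> v \<le> w \<Longrightarrow> lat v \<le> lat w"
  by (simp add: lat_def field_simps)

lemma bounded_lipschitz_on_lat [bl_intros]: "bounded_lipschitz_on UNIV lat"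
proof (rule bounded_lipschitz_onI)
  show "\<bar>lat w\<bar> \<le> 1" for w using lat_less_1[of w] by (simp add: less_imp_le)
  fix v w :: real
  have half: "\<bar>a\<bar> / (1 + a\<^sup>2) \<le> 1 / 2" for a :: real
    using zero_le_power2[of "\<bar>a\<bar> - 1"] by (simp add: field_simps power2_diff)
  \<comment> \<open>The factor \<open>v - w\<close> splits off, and \<open>half\<close> bounds the
    remaining quotient by 1.\<close>
  have "lat v - lat w = (v - w) * ((v + w) / ((1 + v\<^sup>2) * (1 + w\<^sup>2)))"
    by (simp add: lat_def divide_simps) (simp add: algebra_simps power2_eq_square)
  also have "\<bar>\<dots>\<bar> \<le> \<bar>v - w\<bar> * 1"
    unfolding abs_mult
  proof (intro mult_left_mono)
    have "\<bar>(v + w) / ((1 + v\<^sup>2) * (1 + w\<^sup>2))\<bar> \<le> (\<bar>v\<bar> + \<bar>w\<bar>) / ((1 + v\<^sup>2) * (1 + w\<^sup>2))"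
      by (simp add: abs_mult divide_right_mono abs_triangle_ineq)
    also have "\<dots> = \<bar>v\<bar> / (1 + v\<^sup>2) * (1 / (1 + w\<^sup>2)) + \<bar>w\<bar> / (1 + w\<^sup>2) * (1 / (1 + v\<^sup>2))"
      by (simp add: divide_simps)
    also have "\<dots> \<le> 1 / 2 * 1 + 1 / 2 * 1"
      using half[of v] half[of w] by (intro add_mono mult_mono) auto
    finally show "\<bar>(v + w) / ((1 + v\<^sup>2) * (1 + w\<^sup>2))\<bar> \<le> 1" by simp
  qed auto
  finally show "\<bar>lat v - lat w\<bar> \<le> 1 * dist v w" by (simp add: dist_real_def)
qed

subsection \<open>The planar system\<close>

text \<open>The angle ranges over the whole line, so a half turn is the translation by
  \<open>pi\<close>. The functions \<open>A\<close> and \<open>B\<close> stay arbitrary because the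
  reflected, time-reversed motion is another field of this form.\<close>

definition cyl_field :: "(real \<Rightarrow> real) \<Rightarrow> (real \<Rightarrow> real) \<Rightarrow> real \<times> real \<Rightarrow> real \<times> real" where
  "cyl_field A B p =
    (lat (snd p), B (fst p) * lat (snd p) + A (fst p) * (1 - lat (snd p)))"

lemma cyl_solution_iff:
  "solution_in (cyl_field A B) UNIV x \<longleftrightarrow>
    (\<forall>t. ((\<lambda>t. fst (x t)) has_real_derivative lat (snd (x t))) (at t) \<and>
      ((\<lambda>t. snd (x t)) has_real_derivative
        B (fst (x t)) * lat (snd (x t)) + A (fst (x t)) * (1 - lat (snd (x t)))) (at t))"
  (is "_ \<longleftrightarrow> (\<forall>t. ?R t)")
proof -
  have "(x has_vector_derivative cyl_field A B (x t)) (at t) \<longleftrightarrow> ?R t" for t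
  proof
    assume d: "(x has_vector_derivative cyl_field A B (x t)) (at t)"
    show "?R t"
      using bounded_linear.has_vector_derivative[OF bounded_linear_fst d]
        bounded_linear.has_vector_derivative[OF bounded_linear_snd d]
      by (simp add: cyl_field_def has_real_derivative_iff_has_vector_derivative)
  next
    assume "?R t"
    then have "((\<lambda>t. (fst (x t), snd (x t))) has_vector_derivative cyl_field A B (x t)) (at t)"
      unfolding cyl_field_def
      by (intro has_vector_derivative_Pair)
        (auto simp: has_real_derivative_iff_has_vector_derivative)
    then show "(x has_vector_derivative cyl_field A B (x t)) (at t)" by simp
  qed
  then show ?thesis by (simp add: solution_in_def)
qed

lemma bounded_lipschitz_on_isCont:
  fixes f :: "real \<Rightarrow> real"
  assumes "bounded_lipschitz_on UNIV f"
  shows "isCont f x"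
proof -
  obtain L where "L-lipschitz_on UNIV f" using assms unfolding bounded_lipschitz_on_def by blast
  then have "continuous_on UNIV f" by (rule lipschitz_on_continuous_on)
  then show ?thesis by (simp add: continuous_on_eq_continuous_at)
qed

text \<open>The angle never decreases, so the right end \<open>pi / 2\<close> of the interval is the
  one that orbits head for; the zero of \<open>A\<close> makes \<open>(pi / 2, 0)\<close> a critical
  point.\<close>

locale equatorial_flow =
  fixes A B :: "real \<Rightarrow> real"
  assumes A_bl: "bounded_lipschitz_on UNIV A" and B_bl: "bounded_lipschitz_on UNIV B"
    and A_pos: "- (pi / 2) < \<theta> \<Longrightarrow> \<theta> < pi / 2 \<Longrightarrow> 0 < A \<theta>"
    and A_zero: "A (pi / 2) = 0"
begin

abbreviation "F \<equiv> cyl_field A B"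

lemmas isCont_A = bounded_lipschitz_on_isCont[OF A_bl]
  and isCont_B = bounded_lipschitz_on_isCont[OF B_bl]
  and isCont_lat = bounded_lipschitz_on_isCont[OF bounded_lipschitz_on_lat]

lemma F_bounded_lipschitz:
  obtains L where "L-lipschitz_on UNIV F" and "\<And>p. norm (F p) \<le> L"
proof -
  have fst_lip: "1-lipschitz_on UNIV (fst :: real \<times> real \<Rightarrow> real)"
    and snd_lip: "1-lipschitz_on UNIV (snd :: real \<times> real \<Rightarrow> real)"
    by (auto intro!: lipschitz_onI dist_fst_le[of "(_, _)" "(_, _)", simplified]
        dist_snd_le[of "(_, _)" "(_, _)", simplified])
  have 1: "bounded_lipschitz_on UNIV (\<lambda>p::real \<times> real. lat (snd p))"
    by (rule bounded_lipschitz_on_compose[OF bounded_lipschitz_on_lat snd_lip])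
  have 2: "bounded_lipschitz_on UNIV (\<lambda>p::real \<times> real.
      B (fst p) * lat (snd p) + A (fst p) * (1 - lat (snd p)))"
    by (intro bl_intros 1 bounded_lipschitz_on_compose[OF A_bl fst_lip]
        bounded_lipschitz_on_compose[OF B_bl fst_lip])
  obtain C1 L1 where C1: "0 \<le> C1" "0 \<le> L1" "\<And>p. \<bar>fst (F p)\<bar> \<le> C1"
      "\<And>p q. \<bar>fst (F p) - fst (F q)\<bar> \<le> L1 * dist p q"
    by (rule bounded_lipschitz_onE[OF 1]) (auto simp: cyl_field_def)
  obtain C2 L2 where C2: "0 \<le> C2" "0 \<le> L2" "\<And>p. \<bar>snd (F p)\<bar> \<le> C2"
      "\<And>p q. \<bar>snd (F p) - snd (F q)\<bar> \<le> L2 * dist p q"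
    by (rule bounded_lipschitz_onE[OF 2]) (auto simp: cyl_field_def)
  have norm_le: "norm p \<le> \<bar>fst p\<bar> + \<bar>snd p\<bar>" for p :: "real \<times> real"
    using norm_Pair_le[of "fst p" "snd p"] by simp
  show thesis
  proof (rule that)
    show "(L1 + L2 + C1 + C2)-lipschitz_on UNIV F"
    proof (rule lipschitz_onI)
      fix p q
      have "dist (F p) (F q) \<le> L1 * dist p q + L2 * dist p q"
        using norm_le[of "F p - F q"] C1(4)[of p q] C2(4)[of p q] by (simp add: dist_norm)
      also have "\<dots> \<le> (L1 + L2 + C1 + C2) * dist p q"
        using C1(1) C2(1) by (simp add: algebra_simps)
      finally show "dist (F p) (F q) \<le> (L1 + L2 + C1 + C2) * dist p q" .
    qed (use C1 C2 in auto)
    show "norm (F p) \<le> L1 + L2 + C1 + C2" for p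
      using norm_le[of "F p"] C1(3)[of p] C2(3)[of p] C1(2) C2(2) by linarith
  qed
qed

section \<open>Motion of the orbits that start on the equator\<close>

definition flow :: "real \<times> real \<Rightarrow> real \<Rightarrow> real \<times> real" where
  "flow p = (SOME x. solution_in F UNIV x \<and> x 0 = p)"

lemma flow_solution: "solution_in F UNIV (flow p)" and flow_0 [simp]: "flow p 0 = p"
proof -
  have "\<exists>x. solution_in F UNIV x \<and> x 0 = p"
    by (rule F_bounded_lipschitz) (rule global_solution_exists)
  from someI_ex[OF this] show "solution_in F UNIV (flow p)" "flow p 0 = p"
    by (auto simp: flow_def)
qed

lemma flow_unique:
  assumes "solution_in F UNIV x" "solution_in F UNIV y" "x s = y r"
  shows "x (s + t) = y (r + t)"
  by (rule F_bounded_lipschitz) (rule solution_in_unique[OF assms(1,2) _ assms(3)])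

abbreviation ang :: "real \<Rightarrow> real \<Rightarrow> real" where
  "ang s t \<equiv> fst (flow (s, 0) t)"

abbreviation hgt :: "real \<Rightarrow> real \<Rightarrow> real" where
  "hgt s t \<equiv> snd (flow (s, 0) t)"

lemma ang_deriv: "(ang s has_real_derivative lat (hgt s t)) (at t)"
  and hgt_deriv: "(hgt s has_real_derivative
    B (ang s t) * lat (hgt s t) + A (ang s t) * (1 - lat (hgt s t))) (at t)"
  using flow_solution[of "(s, 0)"] unfolding cyl_solution_iff by blast+

lemma ang_cont: "continuous_on S (ang s)" and hgt_cont: "continuous_on S (hgt s)"
  by (rule DERIV_continuous_on[OF has_field_derivative_at_within[OF ang_deriv]],
      rule DERIV_continuous_on[OF has_field_derivative_at_within[OF hgt_deriv]])

lemma ang_mono: "a \<le> b \<Longrightarrow> ang s a \<le> ang s b"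
  by (rule DERIV_nonneg_imp_nondecreasing, assumption, intro exI conjI, rule ang_deriv, simp)

text \<open>The height starts at 0, and wherever it vanishes its derivative is \<open>A\<close> of
  the angle, which is positive on the open half turn.\<close>

lemma hgt_pos_open:
  assumes "- (pi / 2) < s" "0 < t" "ang s t < pi / 2"
  shows "0 < hgt s t"
proof (rule pos_if_pos_derivative_at_zeros[OF hgt_deriv _ \<open>0 < t\<close>])
  fix r assume r: "0 \<le> r" "r \<le> t" "hgt s r = 0"
  have "s \<le> ang s r" "ang s r < pi / 2"
    using ang_mono[OF r(1), of s] ang_mono[OF r(2), of s] assms by auto
  then show "0 < B (ang s r) * lat (hgt s r) + A (ang s r) * (1 - lat (hgt s r))"
    using r(3) A_pos[of "ang s r"] assms(1) by simp
qed simp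

text \<open>Only the final meridian is new. Height 0 there would mean reaching a critical point in
  finite time; a negative height would be preceded by negative heights at angles below
  \<open>pi / 2\<close>.\<close>

lemma hgt_pos:
  assumes s: "- (pi / 2) < s" "s < pi / 2" and t: "0 < t" "ang s t \<le> pi / 2"
  shows "0 < hgt s t"
proof (cases "ang s t < pi / 2")
  case False
  with t(2) have ang_t: "ang s t = pi / 2" by simp
  have "hgt s t \<noteq> 0"
  proof
    assume "hgt s t = 0"
    with ang_t have "flow (s, 0) t = (pi / 2, 0)" by (simp add: prod_eq_iff)
    moreover have "solution_in F UNIV (\<lambda>_. (pi / 2, 0))"
      by (simp add: cyl_solution_iff A_zero)
    ultimately have "flow (s, 0) (t + - t) = (pi / 2, 0)"
      using flow_unique[OF flow_solution, of "\<lambda>_. (pi / 2, 0)"] by blast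
    then show False using s by simp
  qed
  moreover have "\<not> hgt s t < 0"
  proof
    assume "hgt s t < 0"
    obtain d where d: "d > 0" "\<And>h. 0 < h \<Longrightarrow> h < d \<Longrightarrow> ang s (t - h) < ang s t"
      using DERIV_pos_inc_left[OF ang_deriv lat_pos, of s t] \<open>hgt s t < 0\<close> by auto
    have "isCont (hgt s) t" using hgt_deriv DERIV_isCont by blast
    then obtain e where e: "e > 0" "\<And>r. \<bar>r - t\<bar> < e \<Longrightarrow> hgt s r < 0"
      using \<open>hgt s t < 0\<close>
      by (force simp: isCont_def tendsto_def eventually_at dist_real_def
          dest!: spec[of _ "{..<0}"])
    define h where "h = min (min d e) t / 2"
    have h: "0 < h" "h < d" "h < e" "h < t" using d(1) e(1) t(1) by (auto simp: h_def)
    have "0 < hgt s (t - h)"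
      using d(2)[OF h(1,2)] ang_t h by (intro hgt_pos_open[OF s(1)]) auto
    with e(2)[of "t - h"] h show False by simp
  qed
  ultimately show ?thesis by linarith
qed (use assms hgt_pos_open in simp)

section \<open>Order of the orbits over the half turn\<close>

lemma ang_strict_mono:
  assumes s: "- (pi / 2) < s" "s < pi / 2" and ab: "0 \<le> a" "a < b" "ang s b \<le> pi / 2"
  shows "ang s a < ang s b"
proof (rule DERIV_pos_imp_increasing_open[OF ab(2) _ ang_cont])
  fix r assume r: "a < r" "r < b"
  then have "0 < hgt s r"
    using ang_mono[of r b s] ab s by (intro hgt_pos) auto
  then have "0 < lat (hgt s r)" by (simp add: lat_pos)
  then show "\<exists>y. (ang s has_real_derivative y) (at r) \<and> 0 < y"
    using ang_deriv[of s r] by blast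
qed

text \<open>Going back along both orbits by the smaller time puts one of them at its start on the
  equator. The other is then on the equator too, which within the half turn happens only at its own
  start.\<close>

lemma flow_eq_flow_imp:
  assumes s: "- (pi / 2) < s" "s < pi / 2" and s': "- (pi / 2) < s'" "s' < pi / 2"
    and eq: "0 \<le> t" "0 \<le> t'" "flow (s, 0) t = flow (s', 0) t'"
  shows "s = s'"
proof -
  have aux: "s = s'"
    if "- (pi / 2) < s" "s < pi / 2" "- (pi / 2) < s'" "s' < pi / 2" "t' \<le> t"
      "flow (s, 0) t = flow (s', 0) t'" for s s' t t'
  proof -
    have eq: "flow (s, 0) (t - t') = (s', 0)"
      using flow_unique[OF flow_solution flow_solution that(6), of "- t'"] by simp
    have "t - t' = 0"
    proof (rule ccontr)
      assume "t - t' \<noteq> 0"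
      then have "0 < hgt s (t - t')"
        using that eq by (intro hgt_pos) auto
      with eq show False by simp
    qed
    with eq show ?thesis by simp
  qed
  show ?thesis
    using aux[OF s s' _ eq(3)] aux[OF s' s _ eq(3)[symmetric]] by (cases "t' \<le> t") auto
qed

text \<open>Over the half turn the orbits are graphs over the angle and cannot cross. At the angle
  \<open>s'\<close> the orbit from \<open>s\<close> is already above the equator, where the other
  one only starts, so it stays above.\<close>

lemma hgt_strict_antimono:
  assumes s: "- (pi / 2) < s" "s < s'" "s' < pi / 2"
    and t: "0 \<le> t" "0 \<le> t'" "ang s t = ang s' t'" "ang s t \<le> pi / 2"
  shows "hgt s' t' < hgt s t"
proof (rule ccontr)
  assume neg: "\<not> ?thesis"
  have "s' \<le> ang s t" using ang_mono[OF t(2), of s'] t(3) by simp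
  \<comment> \<open>The time at which the left orbit passes over the start of the right one.\<close>
  then obtain t0 where t0: "0 \<le> t0" "t0 \<le> t" "ang s t0 = s'"
    using IVT'[of "ang s" 0 s' t] ang_cont s(2) t(1) by auto
  have "t0 \<noteq> 0" using t0(3) s(2) by auto
  then have pos0: "0 < hgt s t0" using t0 s by (intro hgt_pos) auto
  have inj: "inj_on (ang s') {0..t'}"
  proof (rule strict_mono_on_imp_inj_on, rule strict_mono_onI)
    fix a b assume "a \<in> {0..t'}" "b \<in> {0..t'}" "a < b"
    then show "ang s' a < ang s' b"
      using ang_mono[of b t' s'] t s by (intro ang_strict_mono) auto
  qed
  \<comment> \<open>Time as a function of the angle along the right orbit, used to compare heights
    at equal angles.\<close>
  define g where "g = the_inv_into {0..t'} (ang s')"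
  have g: "g (ang s' r) = r" if "r \<in> {0..t'}" for r
    using the_inv_into_f_f[OF inj that] by (simp add: g_def)
  have image: "\<exists>r\<in>{0..t'}. ang s' r = \<theta>" if "s' \<le> \<theta>" "\<theta> \<le> ang s' t'" for \<theta>
    using IVT'[of "ang s'" 0 \<theta> t'] ang_cont that t(2) by fastforce
  have g_cont: "continuous_on (ang s' ` {0..t'}) g"
    using g by (intro continuous_on_inv ang_cont) auto
  have range: "ang s r \<in> ang s' ` {0..t'}" if "r \<in> {t0..t}" for r
  proof -
    have "s' \<le> ang s r" "ang s r \<le> ang s' t'"
      using ang_mono[of t0 r s] ang_mono[of r t s] that t0(3) t(3) by simp_all
    from image[OF this] obtain q where "q \<in> {0..t'}" "ang s' q = ang s r" by blast
    then show ?thesis using imageI[of q "{0..t'}" "ang s'"] by simp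
  qed
  have "continuous_on {t0..t} (\<lambda>r. g (ang s r))"
    by (rule continuous_on_compose2[OF g_cont ang_cont]) (use range in auto)
  then have cont: "continuous_on {t0..t} (\<lambda>r. hgt s' (g (ang s r)) - hgt s r)"
    by (intro continuous_intros hgt_cont continuous_on_compose2[OF hgt_cont]) auto
  have "hgt s' (g (ang s t0)) - hgt s t0 \<le> 0"
    using g[of 0] t0(3) pos0 t(2) by simp
  moreover have "0 \<le> hgt s' (g (ang s t)) - hgt s t"
    using g[of t'] t neg by simp
  \<comment> \<open>If the order were lost by the end, the heights would agree at some common angle
    and the orbits would meet.\<close>
  ultimately obtain r where r: "t0 \<le> r" "r \<le> t" "hgt s' (g (ang s r)) = hgt s r"
    using IVT'[OF _ _ t0(2) cont, of 0] by auto
  obtain r' where r': "r' \<in> {0..t'}" "ang s' r' = ang s r" using range[of r] r by auto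
  then have "flow (s, 0) r = flow (s', 0) r'"
    using g[OF r'(1)] r(3) by (simp add: prod_eq_iff)
  then have "s = s'" using r' r t0 s by (intro flow_eq_flow_imp) auto
  with s(2) show False by simp
qed

text \<open>An orbit that never completes the half turn has only a finite angle left to travel, so its
  latitude decays; this is possible only at a zero of \<open>A\<close>.\<close>

definition trapped :: "real \<Rightarrow> bool" where
  "trapped s \<longleftrightarrow> (\<forall>t\<ge>0. ang s t < pi / 2)"

lemma trapped_tendsto:
  assumes s: "- (pi / 2) < s" and trap: "trapped s"
  shows "(flow (s, 0) \<longlongrightarrow> (pi / 2, 0)) at_top"
proof -
  obtain M where M0: "\<And>p. norm (F p) \<le> M" by (rule F_bounded_lipschitz) blast
  define M' where "M' = M + 1"
  have M: "M' > 0" "\<And>p. \<bar>snd (F p)\<bar> \<le> M'"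
  proof -
    show "M' > 0" using order_trans[OF norm_ge_zero M0[of 0]] by (simp add: M'_def)
    show "\<bar>snd (F p)\<bar> \<le> M'" for p
      using norm_snd_le[of "snd (F p)" "fst (F p)"] M0[of p] by (simp add: M'_def)
  qed
  have lt: "ang s t < pi / 2" if "t \<ge> 0" for t using trap that by (simp add: trapped_def)
  define l where "l = (SUP t\<in>{0..}. ang s t)"
  have bdd: "bdd_above (ang s ` {0..})" using lt by (auto intro!: bdd_aboveI[of _ "pi / 2"] less_imp_le)
  have le_l: "ang s t \<le> l" if "t \<ge> 0" for t
    unfolding l_def using that bdd by (intro cSUP_upper) auto
  have l_le: "l \<le> pi / 2" unfolding l_def using lt by (intro cSUP_least) (auto intro: less_imp_le)
  have near_l: "\<exists>T\<ge>0. \<forall>t\<ge>T. x < ang s t" if "x < l" for x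
  proof -
    have "\<exists>T\<ge>0. x < ang s T"
    proof (rule ccontr)
      assume "\<not> ?thesis"
      then have "l \<le> x" unfolding l_def by (intro cSUP_least) (auto simp: not_less)
      with that show False by simp
    qed
    then obtain T where "T \<ge> 0" "x < ang s T" by blast
    then show ?thesis using ang_mono[of T _ s] by (intro exI[of _ T]) (auto intro: less_le_trans)
  qed
  have ang_lim: "(ang s \<longlongrightarrow> l) at_top"
  proof (rule increasing_tendsto)
    show "\<forall>\<^sub>F t in at_top. ang s t \<le> l"
      using le_l by (auto simp: eventually_at_top_linorder)
    show "\<forall>\<^sub>F t in at_top. x < ang s t" if "x < l" for x
      using near_l[OF that] by (auto simp: eventually_at_top_linorder)
  qed
  have hgt_small: "\<exists>T\<ge>0. \<forall>t\<ge>T. hgt s t < \<epsilon>" if "\<epsilon> > 0" for \<epsilon>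
  proof -
    \<comment> \<open>During time \<open>h\<close> a height of at least \<open>\<epsilon>\<close>
      cannot fall below \<open>\<epsilon> / 2\<close>, so the angle advances with speed at least
      \<open>\<kappa>\<close>. Beyond \<open>T\<close> less than \<open>\<kappa> * h\<close> is left
      to travel.\<close>
    define h where "h = \<epsilon> / (2 * M')"
    define \<kappa> where "\<kappa> = lat (\<epsilon> / 2)"
    have h: "h > 0" using that M(1) by (simp add: h_def)
    have \<kappa>: "\<kappa> > 0" using that by (simp add: \<kappa>_def lat_pos)
    obtain T where T: "T \<ge> 0" "\<And>t. t \<ge> T \<Longrightarrow> l - \<kappa> * h < ang s t"
      using near_l[of "l - \<kappa> * h"] h \<kappa> by auto
    have "hgt s t < \<epsilon>" if t: "t \<ge> T" for t
    proof (rule ccontr)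
      assume "\<not> hgt s t < \<epsilon>"
      have high: "\<epsilon> / 2 \<le> hgt s r" if r: "t \<le> r" "r \<le> t + h" for r
      proof -
        have "hgt s t + M' * t \<le> hgt s r + M' * r"
        proof (rule DERIV_nonneg_imp_nondecreasing[OF r(1)])
          fix q
          have "((\<lambda>t. hgt s t + M' * t) has_real_derivative snd (F (flow (s, 0) q)) + M') (at q)"
            unfolding cyl_field_def by (auto intro!: derivative_eq_intros hgt_deriv)
          moreover have "0 \<le> snd (F (flow (s, 0) q)) + M'"
            using M(2)[of "flow (s, 0) q"] by linarith
          ultimately show "\<exists>y. ((\<lambda>t. hgt s t + M' * t) has_real_derivative y) (at q) \<and> 0 \<le> y"
            by blast
        qed
        moreover have "M' * (r - t) \<le> M' * h" using r M(1) by (intro mult_left_mono) auto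
        moreover have "M' * h = \<epsilon> / 2" using M(1) by (simp add: h_def)
        ultimately show ?thesis using \<open>\<not> hgt s t < \<epsilon>\<close> by (simp add: right_diff_distrib)
      qed
      have "ang s t - \<kappa> * t \<le> ang s (t + h) - \<kappa> * (t + h)"
      proof (rule DERIV_nonneg_imp_nondecreasing[where f="\<lambda>t. ang s t - \<kappa> * t"])
        fix q assume q: "t \<le> q" "q \<le> t + h"
        have "((\<lambda>t. ang s t - \<kappa> * t) has_real_derivative lat (hgt s q) - \<kappa>) (at q)"
          by (auto intro!: derivative_eq_intros ang_deriv)
        moreover have "0 \<le> lat (hgt s q) - \<kappa>"
          using lat_mono[OF _ high[OF q]] that \<open>\<epsilon> > 0\<close> by (simp add: \<kappa>_def)
        ultimately show "\<exists>y. ((\<lambda>t. ang s t - \<kappa> * t) has_real_derivative y) (at q) \<and> 0 \<le> y"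
          by blast
      qed (use h in simp)
      then show False
        using T(2)[OF t] le_l[of "t + h"] T(1) t h by (simp add: algebra_simps)
    qed
    with T(1) show ?thesis by blast
  qed
  have hgt_lim: "(hgt s \<longlongrightarrow> 0) at_top"
  proof (rule decreasing_tendsto)
    have "0 \<le> hgt s t" if "t > 0" for t
      using hgt_pos_open[OF s that lt] that by simp
    then show "\<forall>\<^sub>F t in at_top. 0 \<le> hgt s t"
      by (auto simp: eventually_at_top_dense)
    show "\<forall>\<^sub>F t in at_top. hgt s t < x" if "0 < x" for x
      using hgt_small[OF that] by (auto simp: eventually_at_top_linorder)
  qed
  \<comment> \<open>Otherwise \<open>A l\<close> is positive and the height eventually grows at a
    rate above \<open>A l / 2\<close>, although it tends to 0.\<close>
  have "l = pi / 2"
  proof (rule ccontr)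
    assume "l \<noteq> pi / 2"
    moreover have "s \<le> l" using le_l[of 0] by simp
    ultimately have Al: "0 < A l" using l_le s by (intro A_pos) auto
    have "((\<lambda>t. B (ang s t) * lat (hgt s t) + A (ang s t) * (1 - lat (hgt s t)))
        \<longlongrightarrow> B l * lat 0 + A l * (1 - lat 0)) at_top"
      by (intro tendsto_intros isCont_tendsto_compose[OF isCont_A ang_lim]
          isCont_tendsto_compose[OF isCont_B ang_lim] isCont_tendsto_compose[OF isCont_lat hgt_lim])
    then have "\<forall>\<^sub>F t in at_top. A l / 2 <
        B (ang s t) * lat (hgt s t) + A (ang s t) * (1 - lat (hgt s t))"
      using Al by (intro order_tendstoD(1)) auto
    then obtain T0 where T0: "\<And>t. t \<ge> T0 \<Longrightarrow> A l / 2 <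
        B (ang s t) * lat (hgt s t) + A (ang s t) * (1 - lat (hgt s t))"
      by (auto simp: eventually_at_top_linorder)
    define T where "T = max T0 1"
    obtain T1 where T1: "T1 \<ge> 0" "\<And>t. t \<ge> T1 \<Longrightarrow> hgt s t < 1"
      using hgt_small[of 1] by auto
    \<comment> \<open>Late enough both for a gain of height 1 since \<open>T\<close> and for the
      height to be below 1.\<close>
    define t where "t = T + 2 / A l + T1"
    have "T \<ge> 1" by (simp add: T_def)
    then have t: "T \<le> t" "T1 \<le> t" "A l / 2 * (t - T) \<ge> 1"
      using Al T1(1) by (auto simp: t_def field_simps)
    have "hgt s T - A l / 2 * T \<le> hgt s t - A l / 2 * t"
    proof (rule DERIV_nonneg_imp_nondecreasing[OF t(1)])
      fix q assume "T \<le> q"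
      then show "\<exists>y. ((\<lambda>t. hgt s t - A l / 2 * t) has_real_derivative y) (at q) \<and> 0 \<le> y"
        using T0[of q] by (intro exI conjI)
          (auto intro!: derivative_eq_intros hgt_deriv simp: T_def)
    qed
    moreover have "0 < hgt s T" using hgt_pos_open[OF s _ lt, of T] by (simp add: T_def)
    ultimately show False using T1(2)[OF t(2)] t(3) by (simp add: algebra_simps)
  qed
  with tendsto_Pair[OF ang_lim hgt_lim] show ?thesis by simp
qed

text \<open>At equal angles the orbit from \<open>s\<close> is higher than the one from
  \<open>s'\<close>. If the latter reached \<open>pi / 2\<close>, it would do so at a positive
  height, while the height of the former tends to 0 there.\<close>

lemma trapped_right:
  assumes s: "- (pi / 2) < s" "s < s'" "s' < pi / 2" and trap: "trapped s"
  shows "trapped s'"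
proof (rule ccontr)
  assume "\<not> trapped s'"
  then obtain t where "t \<ge> 0" "pi / 2 \<le> ang s' t" by (auto simp: trapped_def not_less)
  then obtain \<tau> where \<tau>: "0 \<le> \<tau>" "ang s' \<tau> = pi / 2"
    using IVT'[of "ang s'" 0 "pi / 2" t] ang_cont s(3) by auto
  then have "\<tau> > 0" using s(3) by (cases "\<tau> = 0") auto
  define c where "c = hgt s' \<tau>"
  have c: "c > 0" unfolding c_def using s \<tau> \<open>\<tau> > 0\<close> by (intro hgt_pos) auto
  have "isCont (hgt s') \<tau>" using hgt_deriv DERIV_isCont by blast
  then have "\<forall>\<^sub>F r in at \<tau>. c / 2 < hgt s' r"
    using c by (intro order_tendstoD(1)[of "hgt s'" c]) (auto simp: isCont_def c_def)
  then obtain d where d: "d > 0" "\<And>r. r \<noteq> \<tau> \<Longrightarrow> \<bar>r - \<tau>\<bar> < d \<Longrightarrow> c / 2 < hgt s' r"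
    by (auto simp: eventually_at dist_real_def)
  \<comment> \<open>From \<open>r0\<close> up to \<open>\<tau>\<close> the right orbit is higher
    than \<open>c / 2\<close>.\<close>
  define r0 where "r0 = \<tau> - min d \<tau> / 2"
  have r0: "0 < r0" "r0 < \<tau>" "\<tau> - r0 < d" using d(1) \<open>\<tau> > 0\<close> by (auto simp: r0_def)
  have "ang s' r0 < pi / 2" using ang_strict_mono[of s' r0 \<tau>] s r0 \<tau> by auto
  have lim: "(ang s \<longlongrightarrow> pi / 2) at_top" "(hgt s \<longlongrightarrow> 0) at_top"
    using tendsto_fst[OF trapped_tendsto[OF s(1) trap]]
      tendsto_snd[OF trapped_tendsto[OF s(1) trap]] by auto
  have "\<forall>\<^sub>F t in at_top. t \<ge> 0 \<and> ang s' r0 < ang s t \<and> hgt s t < c / 2"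
    using c \<open>ang s' r0 < pi / 2\<close>
    by (intro eventually_conj eventually_ge_at_top order_tendstoD(1)[OF lim(1)]
        order_tendstoD(2)[OF lim(2)]) auto
  then obtain t where t: "t \<ge> 0" "ang s' r0 < ang s t" "hgt s t < c / 2"
    using eventually_happens'[OF trivial_limit_at_top_linorder] by blast
  have "ang s t < pi / 2" using trap t(1) by (simp add: trapped_def)
  then obtain r where r: "r0 \<le> r" "r \<le> \<tau>" "ang s' r = ang s t"
    using IVT'[of "ang s'" r0 "ang s t" \<tau>] ang_cont t(2) r0 \<tau> by auto
  then have "hgt s' r < hgt s t"
    using \<open>ang s t < pi / 2\<close> r0 t(1) s by (intro hgt_strict_antimono) auto
  moreover have "r \<noteq> \<tau>" using r \<tau> \<open>ang s t < pi / 2\<close> by auto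
  then have "c / 2 < hgt s' r" using d(2)[of r] r r0 by auto
  ultimately show False using t(3) by simp
qed

text \<open>Two trapped orbits would both tend to the cusp and hence meet. The chart
  \<open>\<zeta>\<close> and the field \<open>Y\<close> are left open to cover both the sphere
  system and its time reversal; injectivity is asked on a half strip only, as the angle is
  periodic.\<close>

lemma cusp_not_both_trapped:
  fixes \<zeta> :: "real \<times> real \<Rightarrow> 'b::real_inner"
  assumes cusp: "cusp Y N (\<zeta> (pi / 2, 0))" and lip: "L-lipschitz_on N Y"
    and sol: "\<And>s. solution_in Y N (\<lambda>t. \<zeta> (flow (s, 0) t))"
    and cont: "isCont \<zeta> (pi / 2, 0)"
    and inj: "\<And>p q. \<zeta> p = \<zeta> q \<Longrightarrow> 0 \<le> snd p \<Longrightarrow> 0 \<le> snd q \<Longrightarrow>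
      - (pi / 2) \<le> fst p \<Longrightarrow> fst p \<le> pi / 2 \<Longrightarrow> - (pi / 2) \<le> fst q \<Longrightarrow> fst q \<le> pi / 2 \<Longrightarrow> p = q"
    and s: "- (pi / 2) < s" "s < s'" "s' < pi / 2" and trap: "trapped s" "trapped s'"
  shows False
proof -
  have range: "0 < hgt r t \<and> - (pi / 2) < ang r t \<and> ang r t < pi / 2"
    if "r = s \<or> r = s'" "1 \<le> t" for r t
  proof -
    have "ang r t < pi / 2" using that trap by (auto simp: trapped_def)
    moreover have "r \<le> ang r t" using ang_mono[of 0 t r] that by simp
    ultimately show ?thesis using hgt_pos_open[of r t] that s by auto
  qed
  have lim: "((\<lambda>t. \<zeta> (flow (r, 0) t)) \<longlongrightarrow> \<zeta> (pi / 2, 0)) at_top" if "r = s \<or> r = s'" for r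
    using that s trap by (intro isCont_tendsto_compose[OF cont] trapped_tendsto) auto
  have off: "\<forall>\<^sub>F t in at_top. \<zeta> (flow (r, 0) t) \<noteq> \<zeta> (pi / 2, 0)" if "r = s \<or> r = s'" for r
    using eventually_ge_at_top[of 1]
  proof eventually_elim
    case (elim t)
    with range[OF that elim] inj[of "flow (r, 0) t" "(pi / 2, 0)"] show ?case
      by (auto simp: prod_eq_iff)
  qed
  \<comment> \<open>From time 1 on the heights are positive, so both points lie where
    \<open>\<zeta>\<close> is injective.\<close>
  obtain t t' where t: "t \<ge> 1" "t' \<ge> 1" "\<zeta> (flow (s, 0) t) = \<zeta> (flow (s', 0) t')"
    using cusp_incoming_unique[OF cusp lip sol lim off sol lim off, of s s' 1] by blast
  then have "flow (s, 0) t = flow (s', 0) t'"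
    using range[of s t] range[of s' t'] by (intro inj) auto
  then have "s = s'" using s t by (intro flow_eq_flow_imp) auto
  with s show False by simp
qed

end

text \<open>A trapped orbit traps all orbits starting further right, so it suffices to exclude two.\<close>

locale crossing_flow = equatorial_flow +
  assumes not_both_trapped: "- (pi / 2) < s \<Longrightarrow> s < s' \<Longrightarrow> s' < pi / 2 \<Longrightarrow>
    trapped s \<Longrightarrow> trapped s' \<Longrightarrow> False"
begin

lemma not_trapped:
  assumes "- (pi / 2) < s" "s < pi / 2"
  shows "\<not> trapped s"
proof
  assume trap: "trapped s"
  define s' where "s' = (s + pi / 2) / 2"
  have "s < s'" "s' < pi / 2" using assms by (auto simp: s'_def)
  with assms trap show False using trapped_right[of s s'] not_both_trapped[of s s'] by blast
qed

section \<open>Time and height of the crossing of the meridian\<close>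

definition crossing_time :: "real \<Rightarrow> real" where
  "crossing_time s = (SOME t. 0 < t \<and> ang s t = pi / 2)"

definition crossing_height :: "real \<Rightarrow> real" where
  "crossing_height s = hgt s (crossing_time s)"

context
  fixes s :: real assumes s: "- (pi / 2) < s" "s < pi / 2"
begin

lemma crossing_time_pos: "0 < crossing_time s" and ang_crossing: "ang s (crossing_time s) = pi / 2"
proof -
  obtain t where "t \<ge> 0" "pi / 2 \<le> ang s t"
    using not_trapped[OF s] by (auto simp: trapped_def not_less)
  then obtain \<tau> where \<tau>: "0 \<le> \<tau>" "ang s \<tau> = pi / 2"
    using IVT'[of "ang s" 0 "pi / 2" t] ang_cont s by auto
  then have "0 < \<tau>" using s by (cases "\<tau> = 0") auto
  with \<tau> have "\<exists>t. 0 < t \<and> ang s t = pi / 2" by blast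
  from someI_ex[OF this] show "0 < crossing_time s" "ang s (crossing_time s) = pi / 2"
    by (auto simp: crossing_time_def)
qed

lemma crossing_height_pos: "0 < crossing_height s"
  unfolding crossing_height_def using s crossing_time_pos ang_crossing by (intro hgt_pos) auto

lemma hgt_pos_until_crossing: "0 < t \<Longrightarrow> t \<le> crossing_time s \<Longrightarrow> 0 < hgt s t"
  using ang_mono[of t "crossing_time s" s] ang_crossing by (intro hgt_pos[OF s]) auto

lemma less_crossing_time: "t < crossing_time s \<Longrightarrow> ang s t < pi / 2"
proof (cases "t \<le> 0")
  case True
  then show ?thesis using ang_mono[of t 0 s] s by simp
next
  case False
  then show "t < crossing_time s \<Longrightarrow> ?thesis"
    using ang_strict_mono[OF s, of t "crossing_time s"] ang_crossing by simp
qed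

lemma greater_crossing_time: "crossing_time s < t \<Longrightarrow> pi / 2 < ang s t"
proof -
  assume t: "crossing_time s < t"
  \<comment> \<open>If the angle had not moved since the crossing, \<open>ang_strict_mono\<close>
    would still apply up to \<open>t\<close> and give a strict increase.\<close>
  have "ang s (crossing_time s) \<noteq> ang s t"
  proof
    assume "ang s (crossing_time s) = ang s t"
    then have "ang s (crossing_time s) < ang s t"
      using ang_strict_mono[OF s _ t] crossing_time_pos ang_crossing by simp
    then show False using \<open>ang s (crossing_time s) = ang s t\<close> by simp
  qed
  then show ?thesis using ang_mono[of "crossing_time s" t s] t ang_crossing by simp
qed

end

section \<open>Dependence of the crossing on the starting angle\<close>

lemma crossing_height_strict_antimono:
  assumes "- (pi / 2) < s" "s < s'" "s' < pi / 2"
  shows "crossing_height s' < crossing_height s"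
  unfolding crossing_height_def
  using assms crossing_time_pos[of s] crossing_time_pos[of s'] ang_crossing[of s] ang_crossing[of s']
  by (intro hgt_strict_antimono) auto

text \<open>One constant serves all times, so the bound can also be evaluated at a time that varies
  with the starting angle.\<close>

lemma flow_dependence:
  "\<exists>L. \<forall>s s' t. norm (flow (s, 0) t - flow (s', 0) t) \<le> exp (L * \<bar>t\<bar>) * \<bar>s - s'\<bar>"
proof -
  obtain L where L: "L-lipschitz_on UNIV F" by (rule F_bounded_lipschitz) blast
  have "norm (flow (s, 0) t - flow (s', 0) t) \<le> exp (L * \<bar>t\<bar>) * \<bar>s - s'\<bar>" for s s' t
    using gronwall[OF flow_solution flow_solution L, of "(s, 0)" t "(s', 0)"] by (simp add: norm_Pair)
  then show ?thesis by blast
qed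

text \<open>The angle is below \<open>pi / 2\<close> at each time before the crossing and above it
  at each time after. Both strict inequalities persist for nearby starts and enclose their crossing
  times.\<close>

lemma isCont_crossing_time:
  assumes s: "- (pi / 2) < s" "s < pi / 2"
  shows "isCont crossing_time s"
proof -
  have near: "\<forall>\<^sub>F s' in at s. - (pi / 2) < s' \<and> s' < pi / 2"
    using s by (intro eventually_conj order_tendstoD[OF tendsto_ident_at]) auto
  have lim: "((\<lambda>s'. ang s' t) \<longlongrightarrow> ang s t) (at s)" for t
  proof -
    obtain L where L:
      "\<And>s'. norm (flow (s', 0) t - flow (s, 0) t) \<le> exp (L * \<bar>t\<bar>) * \<bar>s' - s\<bar>"
      using flow_dependence by blast
    have "norm (ang s' t - ang s t) \<le> exp (L * \<bar>t\<bar>) * \<bar>s' - s\<bar>" for s'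
      using dist_fst_le[of "flow (s', 0) t" "flow (s, 0) t"] L[of s'] by (simp add: dist_norm)
    then have "\<forall>\<^sub>F s' in at s. norm (ang s' t - ang s t) \<le> exp (L * \<bar>t\<bar>) * \<bar>s' - s\<bar>"
      by simp
    moreover have "((\<lambda>s'. exp (L * \<bar>t\<bar>) * \<bar>s' - s\<bar>) \<longlongrightarrow> 0) (at s)"
      by (rule tendsto_eq_intros refl | simp)+
    ultimately have "((\<lambda>s'. ang s' t - ang s t) \<longlongrightarrow> 0) (at s)"
      by (rule Lim_null_comparison)
    then show ?thesis by (rule LIM_zero_cancel)
  qed
  show ?thesis
    unfolding isCont_def
  proof (rule order_tendstoI)
    fix a assume "a < crossing_time s"
    then have "\<forall>\<^sub>F s' in at s. ang s' a < pi / 2"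
      using less_crossing_time[OF s] by (intro order_tendstoD(2)[OF lim])
    with near show "\<forall>\<^sub>F s' in at s. a < crossing_time s'"
    proof eventually_elim
      case (elim s')
      then show ?case using ang_mono[of "crossing_time s'" a s'] ang_crossing[of s']
        by (cases "crossing_time s' \<le> a") auto
    qed
  next
    fix a assume "crossing_time s < a"
    then have "\<forall>\<^sub>F s' in at s. pi / 2 < ang s' a"
      using greater_crossing_time[OF s] by (intro order_tendstoD(1)[OF lim])
    with near show "\<forall>\<^sub>F s' in at s. crossing_time s' < a"
    proof eventually_elim
      case (elim s')
      then show ?case using ang_mono[of a "crossing_time s'" s'] ang_crossing[of s']
        by (cases "a \<le> crossing_time s'") auto
    qed
  qed
qed

lemma isCont_crossing_height:
  assumes s: "- (pi / 2) < s" "s < pi / 2"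
  shows "isCont crossing_height s"
proof -
  have ct: "(crossing_time \<longlongrightarrow> crossing_time s) (at s)"
    using isCont_crossing_time[OF s] by (simp add: isCont_def)
  obtain L where L:
    "\<And>s' t. norm (flow (s', 0) t - flow (s, 0) t) \<le> exp (L * \<bar>t\<bar>) * \<bar>s' - s\<bar>"
    using flow_dependence by blast
  have le: "norm (hgt s' t - hgt s t) \<le> exp (L * \<bar>t\<bar>) * \<bar>s' - s\<bar>" for s' t
    using dist_snd_le[of "flow (s', 0) t" "flow (s, 0) t"] L[of s' t] by (simp add: dist_norm)
  \<comment> \<open>The change of height is split into a change of orbit at equal times, controlled
    by Gronwall's bound, and a change of time along one orbit.\<close>
  have "((\<lambda>s'. hgt s' (crossing_time s') - hgt s (crossing_time s')) \<longlongrightarrow> 0) (at s)"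
  proof (rule Lim_null_comparison)
    show "\<forall>\<^sub>F s' in at s. norm (hgt s' (crossing_time s') - hgt s (crossing_time s'))
        \<le> exp (L * \<bar>crossing_time s'\<bar>) * \<bar>s' - s\<bar>"
      by (intro always_eventually allI le)
    show "((\<lambda>s'. exp (L * \<bar>crossing_time s'\<bar>) * \<bar>s' - s\<bar>) \<longlongrightarrow> 0) (at s)"
      by (rule tendsto_eq_intros ct refl | simp)+
  qed
  moreover have "((\<lambda>s'. hgt s (crossing_time s')) \<longlongrightarrow> hgt s (crossing_time s)) (at s)"
    using hgt_deriv DERIV_isCont by (intro isCont_tendsto_compose[OF _ ct]) blast
  ultimately have "((\<lambda>s'. (hgt s' (crossing_time s') - hgt s (crossing_time s')) +
      hgt s (crossing_time s')) \<longlongrightarrow> 0 + hgt s (crossing_time s)) (at s)"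
    by (rule tendsto_add)
  then show ?thesis by (simp add: isCont_def crossing_height_def[abs_def])
qed

text \<open>The bound comes from \<open>d(w\<^sup>3 / 3)/d\<theta> = A + B w\<^sup>2\<close>, whose right-hand side is at most a multiple
  of \<open>2 + w\<^sup>3\<close>.\<close>

lemma crossing_height_small:
  assumes "0 < \<epsilon>"
  shows "\<exists>s\<ge>0. s < pi / 2 \<and> crossing_height s < \<epsilon>"
proof -
  obtain CA where CA: "\<And>x. \<bar>A x\<bar> \<le> CA" using A_bl by (rule bounded_lipschitz_onE) auto
  obtain CB where CB: "\<And>x. \<bar>B x\<bar> \<le> CB" using B_bl by (rule bounded_lipschitz_onE) auto
  define K where "K = 3 * (CA + CB)"
  have bound: "(2 + crossing_height s ^ 3) * exp (- K * (pi / 2)) \<le> 2 * exp (- K * s)"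
    if s: "- (pi / 2) < s" "s < pi / 2" for s
  proof -
    \<comment> \<open>Monotonicity of \<open>N\<close> is the integrated differential inequality,
      with time as the parameter because the angle is stationary at the start.\<close>
    define N where "N t = (2 + hgt s t ^ 3) * exp (- K * ang s t)" for t
    have "N (crossing_time s) \<le> N 0"
    proof (rule DERIV_nonpos_imp_nonincreasing[where f=N])
      fix t assume t: "0 \<le> t" "t \<le> crossing_time s"
      define w where "w = hgt s t"
      define \<theta> where "\<theta> = ang s t"
      define l where "l = lat w"
      have w: "0 \<le> w"
        using hgt_pos_until_crossing[OF s, of t] t by (cases "t = 0") (auto simp: w_def less_imp_le)
      have "(N has_real_derivative
          (3 * w\<^sup>2 * (B \<theta> * l + A \<theta> * (1 - l)) - K * l * (2 + w ^ 3)) * exp (- K * \<theta>)) (at t)"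
        unfolding N_def w_def \<theta>_def l_def
        by (rule derivative_eq_intros hgt_deriv ang_deriv refl | simp add: algebra_simps)+
      moreover have "3 * w\<^sup>2 * (B \<theta> * l + A \<theta> * (1 - l)) \<le> K * l * (2 + w ^ 3)"
      proof -
        \<comment> \<open>This identity gives both terms the common factor \<open>l\<close>, the
          speed of the angle.\<close>
        have l: "w\<^sup>2 * (1 - l) = l" unfolding l_def one_minus_lat by (simp add: lat_def)
        have "3 * w\<^sup>2 * (B \<theta> * l + A \<theta> * (1 - l)) = 3 * w\<^sup>2 * B \<theta> * l + 3 * A \<theta> * (w\<^sup>2 * (1 - l))"
          by (simp add: algebra_simps)
        also have "\<dots> = 3 * l * (B \<theta> * w\<^sup>2 + A \<theta>)" unfolding l by (simp add: algebra_simps)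
        also have "\<dots> \<le> 3 * l * ((CA + CB) * (2 + w ^ 3))"
        proof (intro mult_left_mono)
          have "w\<^sup>2 \<le> 1 + w ^ 3"
          proof (cases "w \<le> 1")
            case True
            then show ?thesis using w power_le_one[of w 2] zero_le_power[of w 3] by linarith
          next
            case False
            then show ?thesis using power_increasing[of 2 3 w] by linarith
          qed
          then have "B \<theta> * w\<^sup>2 \<le> CB * (1 + w ^ 3)"
            using CB[of \<theta>] by (intro mult_mono) auto
          moreover have "0 \<le> CA" "0 \<le> CB" using CA[of 0] CB[of 0] by linarith+
          then have "0 \<le> CA * (1 + w ^ 3) + CB" using w by simp
          moreover have "A \<theta> \<le> CA" using CA[of \<theta>] by linarith
          ultimately show "B \<theta> * w\<^sup>2 + A \<theta> \<le> (CA + CB) * (2 + w ^ 3)"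
            by (simp add: algebra_simps)
        qed (simp add: l_def)
        also have "\<dots> = K * l * (2 + w ^ 3)" by (simp add: K_def)
        finally show ?thesis .
      qed
      then have "(3 * w\<^sup>2 * (B \<theta> * l + A \<theta> * (1 - l)) - K * l * (2 + w ^ 3)) * exp (- K * \<theta>) \<le> 0"
        by (simp add: mult_le_0_iff)
      ultimately show "\<exists>y. (N has_real_derivative y) (at t) \<and> y \<le> 0" by blast
    qed (use crossing_time_pos[OF s] in simp)
    then show ?thesis
      by (simp add: N_def ang_crossing[OF s] crossing_height_def)
  qed
  \<comment> \<open>As \<open>s\<close> approaches \<open>pi / 2\<close>, the bound tends to the
    value that belongs to height 0, so it falls below the one for height
    \<open>\<epsilon>\<close>.\<close>
  have "((\<lambda>s. 2 * exp (- K * s)) \<longlongrightarrow> 2 * exp (- K * (pi / 2))) (at_left (pi / 2))"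
    by (intro tendsto_intros)
  moreover have "2 * exp (- K * (pi / 2)) < (2 + \<epsilon> ^ 3) * exp (- K * (pi / 2))"
    using assms by simp
  ultimately have "\<forall>\<^sub>F s in at_left (pi / 2). 2 * exp (- K * s) < (2 + \<epsilon> ^ 3) * exp (- K * (pi / 2))"
    by (rule order_tendstoD(2))
  moreover have "\<forall>\<^sub>F s in at_left (pi / 2). 0 < s"
    by (intro order_tendstoD(1)[OF tendsto_ident_at]) auto
  moreover have "\<forall>\<^sub>F s in at_left (pi / 2). s < pi / 2"
    by (simp add: eventually_at_filter)
  ultimately have "\<forall>\<^sub>F s in at_left (pi / 2). 0 < s \<and> s < pi / 2 \<and>
      2 * exp (- K * s) < (2 + \<epsilon> ^ 3) * exp (- K * (pi / 2))"
    by eventually_elim simp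
  then obtain s where s: "0 < s" "s < pi / 2"
      "2 * exp (- K * s) < (2 + \<epsilon> ^ 3) * exp (- K * (pi / 2))"
    using eventually_happens'[OF trivial_limit_at_left_real] by blast
  then have "(2 + crossing_height s ^ 3) * exp (- K * (pi / 2)) < (2 + \<epsilon> ^ 3) * exp (- K * (pi / 2))"
    by (intro le_less_trans[OF bound s(3)]) auto
  then have "crossing_height s ^ 3 < \<epsilon> ^ 3"
    unfolding mult_less_cancel_right_pos[OF exp_gt_zero] by simp
  then have "crossing_height s < \<epsilon>" using assms by (meson less_imp_le power_less_imp_less_base)
  with s show ?thesis by (intro exI[of _ s]) auto
qed

end

subsection \<open>Matching the two half turns\<close>

text \<open>The antipodal map in these coordinates: \<open>lat\<close> is even, while
  \<open>A\<close> and \<open>B\<close> change sign under a half turn.\<close>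

lemma cyl_solution_antipode:
  assumes anti: "\<And>\<theta>. A (\<theta> + pi) = - A \<theta>" "\<And>\<theta>. B (\<theta> + pi) = - B \<theta>"
    and y: "solution_in (cyl_field A B) UNIV y"
  shows "solution_in (cyl_field A B) UNIV (\<lambda>t. (fst (y t) + pi, - snd (y t)))"
  unfolding cyl_solution_iff
proof (intro allI conjI)
  fix t
  note d = y[unfolded cyl_solution_iff, THEN spec[of _ t]]
  show "((\<lambda>t. fst (fst (y t) + pi, - snd (y t))) has_real_derivative
      lat (snd (fst (y t) + pi, - snd (y t)))) (at t)"
    using DERIV_add[OF d[THEN conjunct1] DERIV_const[of pi]] by simp
  show "((\<lambda>t. snd (fst (y t) + pi, - snd (y t))) has_real_derivative
      B (fst (fst (y t) + pi, - snd (y t))) * lat (snd (fst (y t) + pi, - snd (y t))) +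
      A (fst (fst (y t) + pi, - snd (y t))) * (1 - lat (snd (fst (y t) + pi, - snd (y t))))) (at t)"
    using DERIV_minus[OF d[THEN conjunct2]] by (simp add: anti)
qed

text \<open>The reflection \<open>\<theta> \<mapsto> pi - \<theta>\<close> combined with time
  reversal. It turns the backward orbit from \<open>(s + pi, 0)\<close> into the forward orbit from
  \<open>(- s, 0)\<close> of the system with reflected \<open>A\<close> and
  \<open>B\<close>.\<close>

lemma cyl_solution_reflect:
  assumes anti: "\<And>\<theta>. A (\<theta> + pi) = - A \<theta>" "\<And>\<theta>. B (\<theta> + pi) = - B \<theta>"
    and y: "solution_in (cyl_field (\<lambda>\<theta>. A (- \<theta>)) (\<lambda>\<theta>. B (- \<theta>))) UNIV y"
  shows "solution_in (cyl_field A B) UNIV (\<lambda>t. (pi - fst (y (- t)), snd (y (- t))))"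
  unfolding cyl_solution_iff
proof (intro allI conjI)
  fix t
  note d = y[unfolded cyl_solution_iff, THEN spec[of _ "- t"]]
  have A: "A (pi - \<theta>) = - A (- \<theta>)" "B (pi - \<theta>) = - B (- \<theta>)" for \<theta>
    using anti[of "- \<theta>"] by (simp_all add: add.commute)
  have m: "(uminus has_real_derivative - 1) (at t)" by (auto intro!: derivative_eq_intros)
  show "((\<lambda>t. fst (pi - fst (y (- t)), snd (y (- t)))) has_real_derivative
      lat (snd (pi - fst (y (- t)), snd (y (- t))))) (at t)"
    using DERIV_diff[OF DERIV_const[of pi] DERIV_chain2[OF d[THEN conjunct1] m]] by simp
  show "((\<lambda>t. snd (pi - fst (y (- t)), snd (y (- t)))) has_real_derivative
      B (fst (pi - fst (y (- t)), snd (y (- t)))) * lat (snd (pi - fst (y (- t)), snd (y (- t)))) +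
      A (fst (pi - fst (y (- t)), snd (y (- t)))) *
        (1 - lat (snd (pi - fst (y (- t)), snd (y (- t)))))) (at t)"
    using DERIV_chain2[OF d[THEN conjunct2] m] by (simp add: A)
qed

locale symmetric_crossing_flow =
  fwd: crossing_flow A B + bwd: crossing_flow "\<lambda>\<theta>. A (- \<theta>)" "\<lambda>\<theta>. B (- \<theta>)" for A B +
  assumes A_anti: "A (\<theta> + pi) = - A \<theta>" and B_anti: "B (\<theta> + pi) = - B \<theta>"
begin

lemma matching_heights:
  "\<exists>s. - (pi / 2) < s \<and> s < pi / 2 \<and> fwd.crossing_height s = bwd.crossing_height (- s)"
proof -
  have "0 < fwd.crossing_height 0" "0 < bwd.crossing_height 0"
    by (auto intro: fwd.crossing_height_pos bwd.crossing_height_pos)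
  \<comment> \<open>Close to its own end each height drops below the value of the other at 0. Since
    both heights are decreasing, they compare in opposite ways at \<open>p\<close> and at
    \<open>- q\<close>.\<close>
  then obtain p q where p: "0 \<le> p" "p < pi / 2" "fwd.crossing_height p < bwd.crossing_height 0"
    and q: "0 \<le> q" "q < pi / 2" "bwd.crossing_height q < fwd.crossing_height 0"
    using fwd.crossing_height_small bwd.crossing_height_small by meson
  have "\<exists>s\<ge>- q. s \<le> p \<and> fwd.crossing_height s - bwd.crossing_height (- s) = 0"
  proof (rule IVT2)
    have "bwd.crossing_height 0 \<le> bwd.crossing_height (- p)"
      using bwd.crossing_height_strict_antimono[of "- p" 0] p by (cases "p = 0") auto
    with p show "fwd.crossing_height p - bwd.crossing_height (- p) \<le> 0" by simp
    have "fwd.crossing_height 0 \<le> fwd.crossing_height (- q)"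
      using fwd.crossing_height_strict_antimono[of "- q" 0] q by (cases "q = 0") auto
    with q show "0 \<le> fwd.crossing_height (- q) - bwd.crossing_height (- (- q))" by simp
    show "\<forall>s. - q \<le> s \<and> s \<le> p \<longrightarrow>
        isCont (\<lambda>s. fwd.crossing_height s - bwd.crossing_height (- s)) s"
    proof (intro allI impI)
      fix s assume "- q \<le> s \<and> s \<le> p"
      then have s: "- (pi / 2) < s" "s < pi / 2" using p q by auto
      have "isCont bwd.crossing_height (- s)"
        using s by (intro bwd.isCont_crossing_height) auto
      then have "isCont (\<lambda>s. bwd.crossing_height (- s)) s"
        by (rule isCont_o2[rotated]) (intro continuous_intros)
      then show "isCont (\<lambda>s. fwd.crossing_height s - bwd.crossing_height (- s)) s"
        by (intro continuous_diff fwd.isCont_crossing_height s)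
    qed
  qed (use p q in simp)
  then obtain s where "- q \<le> s" "s \<le> p" "fwd.crossing_height s = bwd.crossing_height (- s)"
    by auto
  with p q show ?thesis by (intro exI[of _ s]) auto
qed

text \<open>Equal heights make the forward orbit from \<open>(s, 0)\<close> and the backward orbit
  from \<open>(s + pi, 0)\<close> meet on the meridian \<open>pi / 2\<close>, so they are one orbit.
  Its antipode also passes through \<open>(s + pi, 0)\<close> and is therefore its own
  continuation.\<close>

lemma half_turn_orbit:
  "\<exists>s T x. - (pi / 2) < s \<and> s < pi / 2 \<and> 0 < T \<and> solution_in (cyl_field A B) UNIV x \<and>
    x 0 = (s, 0) \<and> (\<forall>t. x (t + T) = (fst (x t) + pi, - snd (x t))) \<and>
    (\<forall>t. 0 < t \<and> t < T \<longrightarrow> 0 < snd (x t))"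
proof -
  obtain s where s: "- (pi / 2) < s" "s < pi / 2"
    and match: "fwd.crossing_height s = bwd.crossing_height (- s)"
    using matching_heights by blast
  have ms: "- (pi / 2) < - s" "- s < pi / 2" using s by auto
  define x where "x = fwd.flow (s, 0)"
  \<comment> \<open>The solution that is at \<open>(s + pi, 0)\<close> at time 0, read off from the
    reflected system.\<close>
  define y where "y t = (pi - fst (bwd.flow (- s, 0) (- t)), snd (bwd.flow (- s, 0) (- t)))" for t
  define a where "a = fwd.crossing_time s"
  define b where "b = bwd.crossing_time (- s)"
  have ab: "0 < a" "0 < b"
    unfolding a_def b_def by (auto intro: fwd.crossing_time_pos bwd.crossing_time_pos s ms)
  have x: "solution_in (cyl_field A B) UNIV x"
    unfolding x_def by (rule fwd.flow_solution)
  have y: "solution_in (cyl_field A B) UNIV y"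
    unfolding y_def by (rule cyl_solution_reflect[OF A_anti B_anti bwd.flow_solution])
  have "x a = y (- b)"
    using match fwd.ang_crossing[OF s] bwd.ang_crossing[OF ms]
    by (simp add: x_def y_def a_def b_def fwd.crossing_height_def bwd.crossing_height_def prod_eq_iff)
  from fwd.flow_unique[OF x y this] have xy: "x (a + t) = y (- b + t)" for t .
  have xT: "x (a + b) = (s + pi, 0)" using xy[of b] by (simp add: y_def)
  have anti: "x (t + (a + b)) = (fst (x t) + pi, - snd (x t))" for t
    using fwd.flow_unique[OF x cyl_solution_antipode[OF A_anti B_anti x], of "a + b" 0 t] xT
    by (simp add: x_def add.commute)
  have pos: "0 < snd (x t)" if t: "0 < t" "t < a + b" for t
  proof (cases "t \<le> a")
    case True
    with t s show ?thesis by (simp add: x_def a_def fwd.hgt_pos_until_crossing)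
  next
    case False
    \<comment> \<open>Past the meridian the heights are those of the reflected orbit before its own
      crossing.\<close>
    then have "0 < snd (bwd.flow (- s, 0) (a + b - t))"
      using t by (intro bwd.hgt_pos_until_crossing[OF ms]) (auto simp: b_def)
    moreover have "x t = y (t - a - b)" using xy[of "t - a"] by (simp add: algebra_simps)
    ultimately show ?thesis by (simp add: y_def algebra_simps)
  qed
  show ?thesis
  proof (intro exI conjI allI impI)
    show "x 0 = (s, 0)" by (simp add: x_def)
    show "x (t + (a + b)) = (fst (x t) + pi, - snd (x t))" for t by (rule anti)
  qed (use s ab x pos in auto)
qed

end

subsection \<open>The system on the sphere\<close>

text \<open>Central projection of the cylinder over the equator onto the sphere without its poles.
  The sign \<open>\<sigma>\<close>, 1 or -1, selects the hemisphere on which \<open>w\<close> is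
  positive, so that \<open>A\<close> can be made positive.\<close>

definition sphere_pt :: "real \<Rightarrow> real \<times> real \<Rightarrow> real^3" where
  "sphere_pt \<sigma> p = (1 / sqrt (1 + (snd p)\<^sup>2)) *\<^sub>R vector [cos (fst p), sin (fst p), - \<sigma> * snd p]"

lemma sphere_pt_nth [simp]:
  "sphere_pt \<sigma> p $ 1 = cos (fst p) / sqrt (1 + (snd p)\<^sup>2)"
  "sphere_pt \<sigma> p $ 2 = sin (fst p) / sqrt (1 + (snd p)\<^sup>2)"
  "sphere_pt \<sigma> p $ 3 = - \<sigma> * snd p / sqrt (1 + (snd p)\<^sup>2)"
  by (simp_all add: sphere_pt_def vector_3)

lemma sphere_pt_unit_sphere:
  assumes "\<sigma>\<^sup>2 = 1"
  shows "sphere_pt \<sigma> p \<in> unit_sphere"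
proof -
  define q where "q = sqrt (1 + (snd p)\<^sup>2)"
  have q: "q * q = 1 + (snd p)\<^sup>2" "q \<noteq> 0" by (simp_all add: q_def)
  have "sphere_pt \<sigma> p \<bullet> sphere_pt \<sigma> p =
      ((cos (fst p))\<^sup>2 + (sin (fst p))\<^sup>2 + \<sigma>\<^sup>2 * (snd p)\<^sup>2) / (q * q)"
    unfolding inner_vec_def sum_3 sphere_pt_nth q_def[symmetric]
    by (simp only: inner_real_def power2_eq_square times_divide_times_eq add_divide_distrib) simp
  also have "\<dots> = 1" using assms q unfolding sin_cos_squared_add2 by simp
  finally show ?thesis by (simp add: unit_sphere_def norm_eq_1)
qed

lemma sphere_pt_antipode: "sphere_pt \<sigma> (fst p + pi, - snd p) = - sphere_pt \<sigma> p"
  by (simp add: vec_eq_iff forall_3)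

lemma has_vector_derivative_vector_3:
  assumes "(f has_real_derivative f') F" "(g has_real_derivative g') F"
    "(h has_real_derivative h') F"
  shows "((\<lambda>t. vector [f t, g t, h t] :: real^3) has_vector_derivative vector [f', g', h']) F"
proof -
  have eq: "(vector [a, b, c] :: real^3) = a *\<^sub>R axis 1 1 + b *\<^sub>R axis 2 1 + c *\<^sub>R axis 3 1"
    for a b c :: real
    by (simp add: vec_eq_iff forall_3 axis_def)
  show ?thesis
    unfolding eq using assms
    by (auto intro!: derivative_eq_intros simp: has_vector_derivative_def has_field_derivative_def algebra_simps)
qed

locale sphere_system =
  fixes a1 a2 a3 b1 b2 \<sigma> :: real
  assumes \<sigma>: "\<sigma>\<^sup>2 = 1"
begin

text \<open>On the equator the third component of the field is
  \<open>- \<sigma> * A \<theta>\<close>; \<open>B\<close> comes from the terms of that component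
  with the additional factor \<open>z3^2\<close>.\<close>

definition A :: "real \<Rightarrow> real" where
  "A \<theta> = \<sigma> * cos \<theta> * (a1 * (cos \<theta>)\<^sup>2 + a2 * cos \<theta> * sin \<theta> + a3 * (sin \<theta>)\<^sup>2)"

definition B :: "real \<Rightarrow> real" where
  "B \<theta> = \<sigma> * (b1 * cos \<theta> + b2 * sin \<theta>)"

abbreviation "X \<equiv> sphere_field a1 a2 a3 b1 b2"

lemma sphere_solution:
  assumes x: "solution_in (cyl_field A B) UNIV x"
  shows "solution_in X unit_sphere (\<lambda>t. sphere_pt \<sigma> (x t))"
  unfolding solution_in_def
proof (intro allI conjI)
  fix t
  define \<theta> where "\<theta> = fst (x t)"
  define w where "w = snd (x t)"
  \<comment> \<open>With a letter for the inverse root, the derivatives and the field become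
    polynomials in \<open>c\<close>, \<open>s\<close>, \<open>w\<close>, \<open>r\<close>,
    \<open>\<sigma>\<close> and the coefficients.\<close>
  define r where "r = 1 / sqrt (1 + w\<^sup>2)"
  define c where "c = cos \<theta>"
  define s where "s = sin \<theta>"
  define \<alpha> where "\<alpha> = c * (a1 * c\<^sup>2 + a2 * c * s + a3 * s\<^sup>2)"
  define \<beta> where "\<beta> = b1 * c + b2 * s"
  define w' where "w' = \<sigma> * (\<beta> * w\<^sup>2 + \<alpha>) * r\<^sup>2"
  note d = x[unfolded cyl_solution_iff, THEN spec[of _ t], folded \<theta>_def w_def]
  have lat_w: "lat w = w\<^sup>2 * r\<^sup>2" by (simp add: r_def lat_def power_divide)
  have d\<theta>: "((\<lambda>t. fst (x t)) has_real_derivative w\<^sup>2 * r\<^sup>2) (at t)"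
    using d[THEN conjunct1] by (simp only: lat_w)
  have "1 - lat w = r\<^sup>2" unfolding one_minus_lat by (simp add: r_def power_divide)
  then have "B \<theta> * lat w + A \<theta> * (1 - lat w) = w'"
    unfolding A_def B_def w'_def \<alpha>_def \<beta>_def c_def s_def lat_w by algebra
  then have dw: "((\<lambda>t. snd (x t)) has_real_derivative w') (at t)"
    using d[THEN conjunct2] by (simp only:)
  have dr: "((\<lambda>t. 1 / sqrt (1 + (snd (x t))\<^sup>2)) has_real_derivative - w * w' * r ^ 3) (at t)"
  proof -
    have "((\<lambda>t. 1 + (snd (x t))\<^sup>2) has_real_derivative 2 * w * w') (at t)"
      using DERIV_add[OF DERIV_const DERIV_power[OF dw, of 2]] by (simp add: w_def mult_ac)
    from DERIV_chain2[OF DERIV_real_sqrt this]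
    have "((\<lambda>t. sqrt (1 + (snd (x t))\<^sup>2)) has_real_derivative r * w * w') (at t)"
      by (simp add: w_def[symmetric] r_def field_simps)
    from DERIV_inverse'[OF this]
    show ?thesis by (simp add: w_def[symmetric] r_def field_simps power3_eq_cube)
  qed
  note e = DERIV_mult[OF dr DERIV_chain2[OF DERIV_cos d\<theta>]]
    DERIV_mult[OF dr DERIV_chain2[OF DERIV_sin d\<theta>]] DERIV_mult[OF dr DERIV_cmult[OF dw, of "- \<sigma>"]]
  note has_vector_derivative_vector_3[OF e, folded \<theta>_def w_def, folded r_def c_def s_def]
  moreover have "(vector [1 / sqrt (1 + (snd (x t))\<^sup>2) * cos (fst (x t)),
      1 / sqrt (1 + (snd (x t))\<^sup>2) * sin (fst (x t)),
      1 / sqrt (1 + (snd (x t))\<^sup>2) * (- \<sigma> * snd (x t))] :: real^3) = sphere_pt \<sigma> (x t)" for t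
    by (simp add: vec_eq_iff forall_3)
  \<comment> \<open>The components agree as polynomials modulo
    \<open>\<sigma>\<^sup>2 = 1\<close>.\<close>
  moreover have "vector [- w * w' * r ^ 3 * c + - s * (w\<^sup>2 * r\<^sup>2) * r,
        - w * w' * r ^ 3 * s + c * (w\<^sup>2 * r\<^sup>2) * r,
        - w * w' * r ^ 3 * (- \<sigma> * w) + - \<sigma> * w' * r] = X (sphere_pt \<sigma> (x t))"
  proof -
    have z: "sphere_pt \<sigma> (x t) $ 1 = r * c" "sphere_pt \<sigma> (x t) $ 2 = r * s"
      "sphere_pt \<sigma> (x t) $ 3 = - \<sigma> * w * r"
      by (simp_all add: r_def c_def s_def \<theta>_def w_def)
    have "- w * w' * r ^ 3 * c + - s * (w\<^sup>2 * r\<^sup>2) * r = X (sphere_pt \<sigma> (x t)) $ 1"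
      unfolding sphere_field_def Let_def vector_3 z w'_def \<alpha>_def \<beta>_def using \<sigma> by algebra
    moreover have "- w * w' * r ^ 3 * s + c * (w\<^sup>2 * r\<^sup>2) * r = X (sphere_pt \<sigma> (x t)) $ 2"
      unfolding sphere_field_def Let_def vector_3 z w'_def \<alpha>_def \<beta>_def using \<sigma> by algebra
    moreover have "- w * w' * r ^ 3 * (- \<sigma> * w) + - \<sigma> * w' * r = X (sphere_pt \<sigma> (x t)) $ 3"
      unfolding sphere_field_def Let_def vector_3 z w'_def \<alpha>_def \<beta>_def using \<sigma> by algebra
    ultimately show ?thesis by (simp only: vec_eq_iff forall_3 vector_3)
  qed
  ultimately show "((\<lambda>t. sphere_pt \<sigma> (x t)) has_vector_derivative X (sphere_pt \<sigma> (x t))) (at t)"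
    by simp
qed (simp add: sphere_pt_unit_sphere \<sigma>)

lemma sphere_field_lipschitz: "\<exists>L. L-lipschitz_on unit_sphere X"
proof -
  have nth: "bounded_lipschitz_on unit_sphere (\<lambda>z. z $ i)" for i :: 3
  proof (rule bounded_lipschitz_onI)
    show "\<bar>z $ i\<bar> \<le> 1" if "z \<in> unit_sphere" for z
      using component_le_norm_cart[of z i] that by (simp add: unit_sphere_def)
    show "\<bar>x $ i - y $ i\<bar> \<le> 1 * dist x y" for x y :: "real^3"
      using component_le_norm_cart[of "x - y" i] by (simp add: dist_norm)
  qed
  have "bounded_lipschitz_on unit_sphere (\<lambda>z. X z $ 1)"
    "bounded_lipschitz_on unit_sphere (\<lambda>z. X z $ 2)"
    "bounded_lipschitz_on unit_sphere (\<lambda>z. X z $ 3)"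
    by (simp_all add: sphere_field_def Let_def vector_3) (intro bl_intros nth)+
  then obtain L1 L2 L3 where L: "L1-lipschitz_on unit_sphere (\<lambda>z. X z $ 1)"
    "L2-lipschitz_on unit_sphere (\<lambda>z. X z $ 2)" "L3-lipschitz_on unit_sphere (\<lambda>z. X z $ 3)"
    unfolding bounded_lipschitz_on_def by blast
  have "(L1 + L2 + L3)-lipschitz_on unit_sphere X"
  proof (rule lipschitz_onI)
    fix x y assume xy: "x \<in> unit_sphere" "y \<in> unit_sphere"
    have "dist (X x) (X y) \<le> \<bar>X x $ 1 - X y $ 1\<bar> + \<bar>X x $ 2 - X y $ 2\<bar> + \<bar>X x $ 3 - X y $ 3\<bar>"
      using norm_le_l1_cart[of "X x - X y"] by (simp add: dist_norm sum_3)
    also have "\<dots> \<le> L1 * dist x y + L2 * dist x y + L3 * dist x y"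
      using L[THEN lipschitz_onD, OF xy] by (simp add: dist_real_def)
    finally show "dist (X x) (X y) \<le> (L1 + L2 + L3) * dist x y" by (simp add: algebra_simps)
  qed (use L[THEN lipschitz_on_nonneg] in simp)
  then show ?thesis by blast
qed

end

section \<open>Injectivity of the chart and the field on the equator\<close>

context sphere_system
begin

text \<open>The third coordinate determines the height, and then the second one the sine of the
  angle; the sine is injective between \<open>- (pi / 2)\<close> and \<open>pi / 2\<close>.\<close>

lemma sphere_pt_eqD:
  assumes eq: "sphere_pt \<sigma> p = sphere_pt \<sigma> q" and pos: "0 \<le> snd p" "0 \<le> snd q"
  shows "snd p = snd q" "sin (fst p) = sin (fst q)"
proof -
  have "(sphere_pt \<sigma> p $ 3)\<^sup>2 = lat (snd p)" for p
    using \<sigma> by (simp add: power_divide power_mult_distrib lat_def)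
  then have "1 - lat (snd p) = 1 - lat (snd q)" using eq by metis
  then have "(snd p)\<^sup>2 = (snd q)\<^sup>2" unfolding one_minus_lat by simp
  with pos show w: "snd p = snd q" by (simp add: power2_eq_iff_nonneg)
  have "sphere_pt \<sigma> p $ 2 = sphere_pt \<sigma> q $ 2" using eq by simp
  then show "sin (fst p) = sin (fst q)" by (simp add: w)
qed

lemma isCont_sphere_pt: "isCont (sphere_pt \<sigma>) p"
proof -
  have "\<forall>i. isCont (\<lambda>p. sphere_pt \<sigma> p $ i) p"
    unfolding forall_3 sphere_pt_nth by (intro conjI continuous_intros) auto
  then show ?thesis by (auto simp: isCont_def intro: vec_tendstoI)
qed

lemma A_bounded_lipschitz: "bounded_lipschitz_on UNIV A"
  and B_bounded_lipschitz: "bounded_lipschitz_on UNIV B"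
  unfolding A_def B_def by (intro bl_intros)+

lemma A_antiperiodic: "A (\<theta> + pi) = - A \<theta>" and B_antiperiodic: "B (\<theta> + pi) = - B \<theta>"
  by (simp_all add: A_def B_def algebra_simps)

lemma A_half_pi: "A (pi / 2) = 0" "A (- (pi / 2)) = 0"
  by (simp_all add: A_def)

lemma sphere_pt_equator: "sphere_pt \<sigma> (\<theta>, 0) \<in> equator"
  using sphere_pt_unit_sphere[OF \<sigma>] by (simp add: equator_def)

lemma sphere_field_equator: "X (sphere_pt \<sigma> (\<theta>, 0)) = vector [0, 0, - \<sigma> * A \<theta>]"
proof -
  define c where "c = cos \<theta>"
  define s where "s = sin \<theta>"
  have z: "sphere_pt \<sigma> (\<theta>, 0) $ 1 = c" "sphere_pt \<sigma> (\<theta>, 0) $ 2 = s"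
    "sphere_pt \<sigma> (\<theta>, 0) $ 3 = 0" by (simp_all add: c_def s_def)
  have "X (sphere_pt \<sigma> (\<theta>, 0)) $ 3 = - (c * (a1 * c\<^sup>2 + a2 * c * s + a3 * s\<^sup>2))"
    unfolding sphere_field_def Let_def vector_3 z
    by (simp add: power2_eq_square power3_eq_cube algebra_simps)
  also have "\<dots> = - (\<sigma>\<^sup>2 * (c * (a1 * c\<^sup>2 + a2 * c * s + a3 * s\<^sup>2)))"
    by (simp only: \<sigma> mult_1_left)
  also have "\<dots> = - \<sigma> * A \<theta>"
    unfolding A_def c_def s_def power2_eq_square[of \<sigma>] by (simp only: mult_minus_left mult.assoc)
  finally have "X (sphere_pt \<sigma> (\<theta>, 0)) $ 3 = - \<sigma> * A \<theta>" .
  moreover have "X (sphere_pt \<sigma> (\<theta>, 0)) $ 1 = 0" "X (sphere_pt \<sigma> (\<theta>, 0)) $ 2 = 0"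
    unfolding sphere_field_def Let_def vector_3 z by simp_all
  ultimately show ?thesis by (simp only: vec_eq_iff forall_3 vector_3)
qed

lemma sphere_field_equator_eq_0: "X (sphere_pt \<sigma> (\<theta>, 0)) = 0 \<longleftrightarrow> A \<theta> = 0"
  using \<sigma> by (auto simp: sphere_field_equator vec_eq_iff forall_3)

end

text \<open>One cusp serves both half turns: forward orbits head for it from angles below
  \<open>pi / 2\<close>, time-reversed ones from angles above.\<close>

locale cusp_system = sphere_system +
  assumes A_pos: "- (pi / 2) < \<theta> \<Longrightarrow> \<theta> < pi / 2 \<Longrightarrow> 0 < A \<theta>"
    and cusp: "cusp X unit_sphere (sphere_pt \<sigma> (pi / 2, 0))"
begin

lemma A_minus_bl: "bounded_lipschitz_on UNIV (\<lambda>\<theta>. A (- \<theta>))"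
  and B_minus_bl: "bounded_lipschitz_on UNIV (\<lambda>\<theta>. B (- \<theta>))"
  by (rule bounded_lipschitz_on_compose[OF A_bounded_lipschitz, of 1] 
      bounded_lipschitz_on_compose[OF B_bounded_lipschitz, of 1],
      auto intro!: lipschitz_onI simp: dist_minus)+

lemma sin_inj_half_turn:
  "sin x = sin y \<Longrightarrow> - (pi / 2) \<le> x \<Longrightarrow> x \<le> pi / 2 \<Longrightarrow> - (pi / 2) \<le> y \<Longrightarrow> y \<le> pi / 2 \<Longrightarrow> x = y"
  using sin_inj_pi by blast

sublocale fwd: crossing_flow A B
proof -
  interpret equatorial_flow A B
    by unfold_locales (use A_bounded_lipschitz B_bounded_lipschitz A_pos A_half_pi in auto)
  obtain L where L: "L-lipschitz_on unit_sphere X" using sphere_field_lipschitz by blast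
  show "crossing_flow A B"
  proof unfold_locales
    fix s s' :: real
    assume s: "- (pi / 2) < s" "s < s'" "s' < pi / 2" and trap: "trapped s" "trapped s'"
    show False
    proof (rule cusp_not_both_trapped[OF cusp L sphere_solution[OF flow_solution]
          isCont_sphere_pt _ s trap])
      fix p q :: "real \<times> real"
      assume "sphere_pt \<sigma> p = sphere_pt \<sigma> q" "0 \<le> snd p" "0 \<le> snd q"
      from sphere_pt_eqD[OF this] show "- (pi / 2) \<le> fst p \<Longrightarrow> fst p \<le> pi / 2 \<Longrightarrow>
          - (pi / 2) \<le> fst q \<Longrightarrow> fst q \<le> pi / 2 \<Longrightarrow> p = q"
        using sin_inj_half_turn by (simp add: prod_eq_iff)
    qed
  qed
qed

sublocale bwd: crossing_flow "\<lambda>\<theta>. A (- \<theta>)" "\<lambda>\<theta>. B (- \<theta>)"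
proof -
  interpret equatorial_flow "\<lambda>\<theta>. A (- \<theta>)" "\<lambda>\<theta>. B (- \<theta>)"
    by unfold_locales (use A_minus_bl B_minus_bl A_pos A_half_pi in auto)
  obtain L where L: "L-lipschitz_on unit_sphere X" using sphere_field_lipschitz by blast
  \<comment> \<open>The chart for the reversed field: it takes the half turn of the reflected system
    to the angles from \<open>pi / 2\<close> to \<open>3 * pi / 2\<close>, with the same cusp at its
    end.\<close>
  define \<zeta> where "\<zeta> p = sphere_pt \<sigma> (pi - fst p, snd p)" for p
  have cusp': "cusp (\<lambda>z. - X z) unit_sphere (\<zeta> (pi / 2, 0))"
    using cusp_reverse[OF cusp] by (simp add: \<zeta>_def)
  have sol: "solution_in (\<lambda>z. - X z) unit_sphere (\<lambda>t. \<zeta> (flow (s, 0) t))" for s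
    using solution_in_reverse[OF sphere_solution[OF
          cyl_solution_reflect[OF A_antiperiodic B_antiperiodic flow_solution]]]
    by (simp add: \<zeta>_def)
  have cont: "isCont \<zeta> (pi / 2, 0)"
    unfolding \<zeta>_def by (intro continuous_at_compose[OF _ isCont_sphere_pt, unfolded o_def]
        continuous_intros)
  show "crossing_flow (\<lambda>\<theta>. A (- \<theta>)) (\<lambda>\<theta>. B (- \<theta>))"
  proof unfold_locales
    fix s s' :: real
    assume s: "- (pi / 2) < s" "s < s'" "s' < pi / 2" and trap: "trapped s" "trapped s'"
    show False
    proof (rule cusp_not_both_trapped[OF cusp' lipschitz_on_uminus_comp[OF L] sol cont _ s trap])
      fix p q :: "real \<times> real"
      assume "\<zeta> p = \<zeta> q" "0 \<le> snd p" "0 \<le> snd q"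
      then have "snd p = snd q" "sin (fst p) = sin (fst q)"
        using sphere_pt_eqD[of "(pi - fst p, snd p)" "(pi - fst q, snd q)"] by (auto simp: \<zeta>_def)
      then show "- (pi / 2) \<le> fst p \<Longrightarrow> fst p \<le> pi / 2 \<Longrightarrow>
          - (pi / 2) \<le> fst q \<Longrightarrow> fst q \<le> pi / 2 \<Longrightarrow> p = q"
        using sin_inj_half_turn by (simp add: prod_eq_iff)
    qed
  qed
qed

sublocale symmetric_crossing_flow A B
  by unfold_locales (fact A_antiperiodic B_antiperiodic)+

text \<open>On the sphere the half turn orbit satisfies \<open>z (t + T) = - z t\<close>, which
  gives the period \<open>2 * T\<close> and the symmetry. It is off the equator between times 0 and
  \<open>T\<close>, so it meets the equator only in \<open>z 0\<close> and
  \<open>- z 0\<close>.\<close>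

lemma symmetric_periodic_solution:
  "\<exists>x. periodic_solution_in X unit_sphere x \<and> uminus ` range x = range x \<and>
     (\<exists>p. range x \<inter> equator = {p, - p} \<and> X p \<noteq> 0 \<and> X (- p) \<noteq> 0)"
proof -
  obtain s T x where s: "- (pi / 2) < s" "s < pi / 2" and T: "0 < T"
    and x: "solution_in (cyl_field A B) UNIV x" "x 0 = (s, 0)"
    and turn: "\<And>t. x (t + T) = (fst (x t) + pi, - snd (x t))"
    and pos: "\<And>t. 0 < t \<Longrightarrow> t < T \<Longrightarrow> 0 < snd (x t)"
    using half_turn_orbit by blast
  define z where "z t = sphere_pt \<sigma> (x t)" for t
  have anti: "z (t + T) = - z t" for t
    by (simp add: z_def turn sphere_pt_antipode)
  have sol: "solution_in X unit_sphere z"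
    unfolding z_def by (rule sphere_solution[OF x(1)])
  have shift: "z (t + real n * T) \<in> {z t, - z t}" for t n
  proof (induction n)
    case (Suc n)
    have "z (t + real (Suc n) * T) = - z (t + real n * T)"
      using anti[of "t + real n * T"] by (simp add: algebra_simps)
    with Suc show ?case by auto
  qed simp
  have equator: "z t \<in> {z 0, - z 0}" if "z t \<in> equator" for t
  proof -
    \<comment> \<open>Time is reduced modulo \<open>T\<close> to \<open>u\<close>, at the cost of a
      sign.\<close>
    define n where "n = \<lfloor>t / T\<rfloor>"
    define u where "u = t - of_int n * T"
    have "of_int n \<le> t / T" "t / T < of_int n + 1" unfolding n_def by linarith+
    then have u: "0 \<le> u" "u < T" using T by (auto simp: u_def field_simps)
    have tu: "z t \<in> {z u, - z u}"
    proof (cases "0 \<le> n")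
      case True
      then show ?thesis using shift[of u "nat n"] by (simp add: u_def)
    next
      case False
      \<comment> \<open>\<open>shift\<close> goes forward only, so for negative \<open>n\<close> it
        leads from \<open>t\<close> to \<open>u\<close>.\<close>
      then have "z u \<in> {z t, - z t}" using shift[of t "nat (- n)"] by (simp add: u_def)
      then show ?thesis by auto
    qed
    then have "z u $ 3 = 0" using that by (auto simp: equator_def)
    then have "snd (x u) = 0" using \<sigma> by (auto simp: z_def)
    with pos[of u] u have "u = 0" by (cases "u = 0") auto
    with tu show ?thesis by simp
  qed
  have z0: "z 0 \<in> equator" "X (z 0) \<noteq> 0"
    using A_pos[OF s] by (auto simp: z_def x(2) sphere_pt_equator sphere_field_equator_eq_0)
  have "z T = sphere_pt \<sigma> (s + pi, 0)" using turn[of 0] by (simp add: z_def x(2))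
  then have zT: "z T \<in> equator" "X (z T) \<noteq> 0"
    using A_pos[OF s] A_antiperiodic[of s]
    by (simp_all only: sphere_pt_equator sphere_field_equator_eq_0)
  have zT_eq: "z T = - z 0" using anti[of 0] by simp
  have "z 0 \<noteq> - z 0"
  proof
    assume "z 0 = - z 0"
    then have "z 0 = 0" by (simp add: vec_eq_iff)
    then show False using z0(1) by (simp add: equator_def unit_sphere_def)
  qed
  have "periodic_solution_in X unit_sphere z"
    unfolding periodic_solution_in_def
  proof (intro conjI exI allI sol)
    show "0 < 2 * T" using T by simp
    show "z (t + 2 * T) = z t" for t
      using anti[of "t + T"] anti[of t] by (simp add: algebra_simps)
    show "\<not> z constant_on UNIV"
      using zT_eq \<open>z 0 \<noteq> - z 0\<close> unfolding constant_on_def by (metis UNIV_I)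
  qed
  moreover have "uminus ` range z = range z"
  proof -
    have "- z t \<in> range z" for t using anti[of t] by (metis rangeI)
    then show ?thesis by force
  qed
  moreover have "range z \<inter> equator = {z 0, - z 0}"
    using equator z0(1) zT(1) unfolding zT_eq[symmetric] by auto
  ultimately show ?thesis using z0(2) zT(2) unfolding zT_eq by blast
qed

end

theorem theorem3p9:
  fixes a1 a2 a3 b1 b2 :: real
  assumes "(a1, a2, a3) \<noteq> (0, 0, 0)"
    and "\<exists>p q. p \<noteq> q \<and>
           {z \<in> equator. sphere_field a1 a2 a3 b1 b2 z = 0} = {p, q} \<and>
           cusp (sphere_field a1 a2 a3 b1 b2) unit_sphere p \<and>
           cusp (sphere_field a1 a2 a3 b1 b2) unit_sphere q"
  shows "\<exists>x. periodic_solution_in (sphere_field a1 a2 a3 b1 b2) unit_sphere x \<and>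
           uminus ` range x = range x \<and>
           (\<exists>p. range x \<inter> equator = {p, - p} \<and>
              sphere_field a1 a2 a3 b1 b2 p \<noteq> 0 \<and>
              sphere_field a1 a2 a3 b1 b2 (- p) \<noteq> 0)"
proof -
  obtain p q where critical: "{z \<in> equator. sphere_field a1 a2 a3 b1 b2 z = 0} = {p, q}"
    and cusps: "cusp (sphere_field a1 a2 a3 b1 b2) unit_sphere p"
      "cusp (sphere_field a1 a2 a3 b1 b2) unit_sphere q"
    using assms(2) by blast
  \<comment> \<open>This sign makes \<open>A 0\<close> equal to the absolute value of
    \<open>a1\<close>.\<close>
  define \<sigma> :: real where "\<sigma> = (if a1 < 0 then - 1 else 1)"
  interpret sphere_system a1 a2 a3 b1 b2 \<sigma>
    by unfold_locales (simp add: \<sigma>_def)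
  have zero: "sphere_pt \<sigma> (\<theta>, 0) \<in> {p, q} \<longleftrightarrow> A \<theta> = 0" for \<theta>
    unfolding critical[symmetric] by (simp add: sphere_pt_equator sphere_field_equator_eq_0)
  define N where "N = sphere_pt \<sigma> (pi / 2, 0)"
  \<comment> \<open>The factor \<open>cos \<theta>\<close> of \<open>A\<close> vanishes at
    \<open>pi / 2\<close> and half a turn later, so \<open>N\<close> and \<open>- N\<close> are
    critical and must be the two given points.\<close>
  have N: "N \<in> {p, q}" "- N \<in> {p, q}"
    using zero[of "pi / 2"] zero[of "pi / 2 + pi"] A_antiperiodic[of "pi / 2"]
      sphere_pt_antipode[of \<sigma> "(pi / 2, 0)"] by (auto simp: N_def A_def)
  have N2: "N $ 2 = 1" by (simp add: N_def)
  then have "N \<noteq> - N" by (metis equal_neg_zero one_neq_zero vector_uminus_component)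
  with N have pq: "{p, q} = {N, - N}" by auto
  have nonzero: "A \<theta> \<noteq> 0" if "- (pi / 2) < \<theta>" "\<theta> < pi / 2" for \<theta>
  proof
    assume "A \<theta> = 0"
    then have "sphere_pt \<sigma> (\<theta>, 0) \<in> {N, - N}" using zero pq by blast
    then have "(sphere_pt \<sigma> (\<theta>, 0) $ 2)\<^sup>2 = 1"
      using N2 by (auto simp del: sphere_pt_nth)
    then have "(sin \<theta>)\<^sup>2 = 1" by simp
    then have "cos \<theta> = 0" using sin_cos_squared_add[of \<theta>] by simp
    with cos_gt_zero_pi[of \<theta>] that show False by simp
  qed
  have "A 0 = \<bar>a1\<bar>" unfolding A_def by (simp add: \<sigma>_def)
  then have "0 < A 0" using nonzero[of 0] by simp
  \<comment> \<open>A continuous function without zeros on an interval keeps the sign that it has at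
    0.\<close>
  have pos: "0 < A \<theta>" if \<theta>: "- (pi / 2) < \<theta>" "\<theta> < pi / 2" for \<theta>
  proof (rule ccontr)
    assume "\<not> 0 < A \<theta>"
    have "continuous_on {- (pi / 2)<..<pi / 2} A"
      by (simp add: bounded_lipschitz_on_isCont[OF A_bounded_lipschitz] continuous_at_imp_continuous_on)
    then have "connected (A ` {- (pi / 2)<..<pi / 2})"
      by (rule connected_continuous_image) simp
    moreover have "A \<theta> \<in> A ` {- (pi / 2)<..<pi / 2}" "A 0 \<in> A ` {- (pi / 2)<..<pi / 2}"
      using \<theta> by auto
    ultimately have "{A \<theta>..A 0} \<subseteq> A ` {- (pi / 2)<..<pi / 2}"
      by (rule connected_contains_Icc)
    moreover have "0 \<in> {A \<theta>..A 0}" using \<open>\<not> 0 < A \<theta>\<close> \<open>0 < A 0\<close> by simp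
    ultimately obtain \<theta>' where "- (pi / 2) < \<theta>'" "\<theta>' < pi / 2" "A \<theta>' = 0" by force
    with nonzero show False by blast
  qed
  have "cusp X unit_sphere N" using N(1) cusps by auto
  then interpret cusp_system a1 a2 a3 b1 b2 \<sigma>
    by unfold_locales (auto simp: N_def pos)
  show ?thesis by (rule symmetric_periodic_solution)
qed

end
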